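(* There is a numerical constant $C>0$ such that for all real $\beta\ge1$, all integers $n\ge1$, all real $\kappa\ge n+1$, and all $$0<\varepsilon\le \sqrt{\tfrac{n}{\kappa}}\,\bigl(\alpha^{14}\wedge \alpha^{2}n^{-2/5}\bigr),\qquad \text{where } \alpha=1-\sqrt{n/\kappa},$$ one has $$\mathbb{P}\Bigl( \lambda_{\min}(L_{\beta}) \le (\sqrt{\kappa}-\sqrt{n})^2(1-\varepsilon) \Bigr) \le C e^{-\beta(\kappa n)^{1/4}(\sqrt{\kappa}-\sqrt{n})\,\varepsilon^{3/2}/C}.$$
   Context: For $\beta>0$, an integer $n\ge1$ and a real number $\kappa>n-1$, the $\beta$-Laguerre ensemble $L_\beta$ is the law of $n$ random positive points $(\lambda_1,\dots,\lambda_n)$ with joint density on $(0,\infty)^n$ proportional to $$\prod_{j<k}|\lambda_j-\lambda_k|^{\beta}\prod_{k=1}^n w(\lambda_k),\qquad w(\lambda)=\lambda^{\frac{\beta}{2}(\kappa-n+1)-1}e^{-\beta\lambda/2}.$$ $\lambda_{\min}(L_\beta)=\min_{1\le k\le n}\lambda_k$. The symbol $\wedge$ denotes minimum. A numerical constant is an absolute one, independent of $n$, $\kappa$, $\varepsilon$ and $\beta$. *)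

theory Defs
  imports "HOL-Probability.Probability"
begin

definition laguerre_weight :: "real \<Rightarrow> nat \<Rightarrow> real \<Rightarrow> real \<Rightarrow> real" where
  "laguerre_weight \<beta> n \<kappa> t =
     t powr (\<beta> / 2 * (\<kappa> - real n + 1) - 1) * exp (- \<beta> * t / 2)"

definition laguerre_unnorm_density :: "real \<Rightarrow> nat \<Rightarrow> real \<Rightarrow> (nat \<Rightarrow> real) \<Rightarrow> real" where
  "laguerre_unnorm_density \<beta> n \<kappa> x =
     (if \<forall>k<n. 0 < x k
      then (\<Prod>k<n. \<Prod>j<k. \<bar>x j - x k\<bar> powr \<beta>) * (\<Prod>k<n. laguerre_weight \<beta> n \<kappa> (x k))
      else 0)"

definition laguerre_partition :: "real \<Rightarrow> nat \<Rightarrow> real \<Rightarrow> ennreal" where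
  "laguerre_partition \<beta> n \<kappa> =
     (\<integral>\<^sup>+ x. ennreal (laguerre_unnorm_density \<beta> n \<kappa> x) \<partial>(\<Pi>\<^sub>M k\<in>{..<n}. lborel))"

(* A point configuration is a function in the extensional product over {..<n}, so the points
   are indexed from 0.  The law is only meaningful for \<beta> > 0 and \<kappa> > n - 1, when the
   partition function is positive and finite. *)
definition laguerre_ensemble :: "real \<Rightarrow> nat \<Rightarrow> real \<Rightarrow> (nat \<Rightarrow> real) measure" where
  "laguerre_ensemble \<beta> n \<kappa> =
     density (\<Pi>\<^sub>M k\<in>{..<n}. lborel)
       (\<lambda>x. ennreal (laguerre_unnorm_density \<beta> n \<kappa> x) / laguerre_partition \<beta> n \<kappa>)"

definition lambda_min :: "nat \<Rightarrow> (nat \<Rightarrow> real) \<Rightarrow> real" where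
  "lambda_min n x = Min (x ` {..<n})"

end

theory Submission
  imports Defs
begin

text \<open>
  The density \<open>f\<close> of the smallest point satisfies a second order differential inequality on
  \<open>(0, \<infinity>)\<close>, and the tail bound is the decay that this inequality forces below the edge
  \<open>s = (\<surd>\<kappa> - \<surd>n)\<^sup>2\<close>.

  Fix the smallest point \<open>t\<close> and describe the other \<open>N = n - 1\<close> points by their gaps
  \<open>y\<^sub>j = \<lambda>\<^sub>j - t > 0\<close>. With \<open>a = \<beta>/2 (\<kappa> - n + 1) - 1\<close>, the joint density of \<open>t\<close> and the gaps is
  \<open>\<omega>(t, y) = |\<Delta>(y)|\<^sup>\<beta> \<Prod> y\<^sub>j\<^sup>\<beta> w(t) \<Prod> w(t + y\<^sub>j)\<close> with \<open>w(u) = u\<^sup>a e\<close> to the \<open>-\<beta>u/2\<close>; all singular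
  factors depend on \<open>y\<close> alone, so \<open>f(t) = \<integral> \<omega>(t, y) dy\<close> is smooth in \<open>t\<close>. Write \<open>\<langle>h\<rangle>\<close> for
  \<open>\<integral> h \<omega>\<close>, \<open>P = a/t - \<beta>/2\<close>, \<open>S = \<Sum> 1/y\<^sub>j\<close>, \<open>R = \<Sum> 1/(t + y\<^sub>j)\<close> and \<open>W = a R - \<beta> N/2\<close>.
  Integration by parts in the gaps along the vector fields \<open>v\<^sub>j = 1\<close>, \<open>v\<^sub>j = S\<close> and \<open>v\<^sub>j = 1/y\<^sub>j\<close>
  gives three identities (loop equations). The first says \<open>\<langle>W\<rangle> = -\<beta>\<langle>S\<rangle>\<close>, whence \<open>f' = P f - \<beta>\<langle>S\<rangle>\<close>,
  and the other two together say
  \<open>-\<beta>\<langle>S W\<rangle> = 2\<beta>a/t (\<langle>S\<rangle> - \<langle>R\<rangle>) - \<beta>\<^sup>2\<langle>S\<rangle> + 3\<beta>(\<beta> - 1)\<langle>\<Sum> 1/y\<^sub>j\<^sup>2\<rangle>\<close>. For \<open>\<beta> \<ge> 1\<close> the last term is nonnegative,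
  and dropping it leaves quantities that are expressible by \<open>f\<close> and \<open>f'\<close>:
  \<open>f'' + (2\<beta>/t) f' \<ge> q f\<close> with \<open>t\<^sup>2 q = (a - \<beta>t/2)\<^sup>2 - a + 2\<beta>(a - \<beta>t/2) - \<beta>\<^sup>2 N t\<close>.
  Since \<open>\<Sum> 1/y\<^sub>j\<^sup>2\<close> need not be integrable when \<open>\<beta> = 1\<close>, the poles are moved to \<open>-\<tau>\<close> and \<open>\<tau> \<rightarrow> 0\<close>
  is taken after that term has been dropped (\<open>loop_equation\<close>, \<open>gap_inequality\<close>).

  To leading order \<open>t\<^sup>2 q\<close> is \<open>\<beta>\<^sup>2/4\<close> times the quadratic with roots \<open>(\<surd>\<kappa> \<plusminus> \<surd>n)\<^sup>2\<close>, so that below the edge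
  \<open>t\<^sup>2 q \<ge> \<beta>\<^sup>2/4 (1 + 2(s - t)\<surd>(\<kappa>n))\<close> (\<open>edge_potential_lower_bound\<close>). If a constant \<open>K \<ge> 0\<close> satisfies
  \<open>K\<^sup>2 + 2\<beta>K/t \<le> q\<close>, the operator factors as \<open>(d/dt + 2\<beta>/t + K)(d/dt - K)\<close> up to a term of the right
  sign; hence \<open>f' \<ge> K f\<close>, and shifting the smallest point upwards by \<open>d\<close> increases its density at
  least by the factor \<open>e\<close> to the \<open>K d\<close> (\<open>edge_density_growth\<close>). Integrating over \<open>t\<close>, the probability of
  \<open>lambda_min \<le> s(1 - \<epsilon>)\<close> is at most \<open>e\<close> to the \<open>-K d\<close>, because the normalising constant is common to both sides.
  The admissible choices \<open>K = \<beta>/(5s) \<surd>(s\<epsilon>\<surd>(\<kappa>n))\<close> and \<open>d = s\<epsilon>/4\<close> give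
  \<open>K d = \<beta> (\<kappa>n)\<close> to the \<open>1/4\<close> times \<open>(\<surd>\<kappa> - \<surd>n) \<epsilon>\<surd>\<epsilon>/20\<close>.
  The lower bound on \<open>q\<close> can fail only for \<open>s < 1\<close> and \<open>\<beta> < 2\<close>; then the exponent
  is at most \<open>2\<close> before division by \<open>20\<close>, and the claimed bound exceeds \<open>1\<close>.
\<close>

section \<open>Calculus and measure theory\<close>

text \<open>
  The mean value theorem bounds the difference quotients by the same \<open>G\<close>, so dominated
  convergence applies along every sequence tending to \<open>t\<close>.
\<close>

lemma has_real_derivative_under_integral:
  fixes F F' :: "real \<Rightarrow> 'a \<Rightarrow> real"
  assumes t: "c < t" "t < d"
    and int: "\<And>s. c < s \<Longrightarrow> s < d \<Longrightarrow> integrable M (F s)"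
    and der: "\<And>s y. c < s \<Longrightarrow> s < d \<Longrightarrow> y \<in> space M \<Longrightarrow>
                ((\<lambda>s. F s y) has_real_derivative F' s y) (at s)"
    and bnd: "\<And>s y. c < s \<Longrightarrow> s < d \<Longrightarrow> y \<in> space M \<Longrightarrow> \<bar>F' s y\<bar> \<le> G y"
    and G: "integrable M G"
    and meas: "F' t \<in> borel_measurable M"
  shows "((\<lambda>s. \<integral>y. F s y \<partial>M) has_real_derivative (\<integral>y. F' t y \<partial>M)) (at t)"
proof -
  have "((\<lambda>s. ((\<integral>y. F s y \<partial>M) - (\<integral>y. F t y \<partial>M)) / (s - t)) \<longlongrightarrow> (\<integral>y. F' t y \<partial>M)) (at t)"
    unfolding tendsto_at_iff_sequentially
  proof (intro allI impI)
    fix X :: "nat \<Rightarrow> real"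
    assume X: "\<forall>i. X i \<in> UNIV - {t}" "X \<longlonglongrightarrow> t"
    have "\<forall>\<^sub>F i in sequentially. X i \<in> {c<..<d}"
      using X(2) t by (intro topological_tendstoD) auto
    then obtain k where k: "\<And>i. i \<ge> k \<Longrightarrow> c < X i \<and> X i < d"
      by (auto simp: eventually_sequentially)
    define Y where "Y i = X (i + k)" for i
    have Y: "c < Y i" "Y i < d" "Y i \<noteq> t" for i
      using k[of "i + k"] X(1) by (auto simp: Y_def)
    have Ylim: "Y \<longlonglongrightarrow> t" unfolding Y_def by (rule LIMSEQ_ignore_initial_segment[OF X(2)])
    have "(\<lambda>i. \<integral>y. (F (Y i) y - F t y) / (Y i - t) \<partial>M) \<longlonglongrightarrow> (\<integral>y. F' t y \<partial>M)"
    proof (rule integral_dominated_convergence[where w = G])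
      show "AE y in M. (\<lambda>i. (F (Y i) y - F t y) / (Y i - t)) \<longlonglongrightarrow> F' t y"
      proof (rule AE_I2)
        fix y assume "y \<in> space M"
        then have "((\<lambda>s. (F s y - F t y) / (s - t)) \<longlongrightarrow> F' t y) (at t)"
          using der[of t y] t by (auto simp: has_field_derivative_iff)
        then show "(\<lambda>i. (F (Y i) y - F t y) / (Y i - t)) \<longlonglongrightarrow> F' t y"
          unfolding tendsto_at_iff_sequentially using Y Ylim by (auto simp: o_def)
      qed
      show "AE y in M. norm ((F (Y i) y - F t y) / (Y i - t)) \<le> G y" for i
      proof (rule AE_I2)
        fix y assume y: "y \<in> space M"
        have "norm (F (Y i) y - F t y) \<le> G y * norm (Y i - t)"
        proof (rule field_differentiable_bound[where S = "{c<..<d}"])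
          show "((\<lambda>s. F s y) has_field_derivative F' z y) (at z within {c<..<d})"
            if "z \<in> {c<..<d}" for z
            using der[of z y] that y by (auto intro: has_field_derivative_at_within)
        qed (use bnd y Y t in auto)
        then show "norm ((F (Y i) y - F t y) / (Y i - t)) \<le> G y"
          using Y(3)[of i] by (simp add: divide_le_eq)
      qed
      show "(\<lambda>y. (F (Y i) y - F t y) / (Y i - t)) \<in> borel_measurable M" for i
        using int[of "Y i"] int[of t] Y t by measurable
    qed (use G meas in auto)
    moreover have "(\<integral>y. (F (Y i) y - F t y) / (Y i - t) \<partial>M)
                     = ((\<integral>y. F (Y i) y \<partial>M) - (\<integral>y. F t y \<partial>M)) / (Y i - t)" for i
      using int[of "Y i"] int[of t] Y t by simp
    ultimately have "(\<lambda>i. ((\<integral>y. F (X (i + k)) y \<partial>M) - (\<integral>y. F t y \<partial>M)) / (X (i + k) - t))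
        \<longlonglongrightarrow> (\<integral>y. F' t y \<partial>M)" unfolding Y_def by (simp only:)
    then show "((\<lambda>s. ((\<integral>y. F s y \<partial>M) - (\<integral>y. F t y \<partial>M)) / (s - t)) \<circ> X)
        \<longlonglongrightarrow> (\<integral>y. F' t y \<partial>M)"
      unfolding o_def by (rule LIMSEQ_offset)
  qed
  then show ?thesis by (simp add: has_field_derivative_iff)
qed

text \<open>
  Integration by parts on a half line needs an exceptional set: for \<open>\<beta> = 1\<close> the density has a
  corner wherever two points collide.
\<close>

lemma integral_derivative_eq_0:
  fixes g g' :: "real \<Rightarrow> real"
  assumes cont: "continuous_on {0..} g" and g0: "g 0 = 0" and lim: "(g \<longlongrightarrow> 0) at_top"
    and fin: "finite S" and der: "\<And>x. 0 < x \<Longrightarrow> x \<notin> S \<Longrightarrow> (g has_real_derivative g' x) (at x)"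
    and int: "integrable lborel (\<lambda>x. indicator {0<..} x * g' x)"
  shows "(\<integral>x. indicator {0<..} x * g' x \<partial>lborel) = 0"
proof -
  let ?h = "\<lambda>x. indicator {0<..} x * g' x"
  have eq: "(\<integral>x. indicator {0..real n} x * ?h x \<partial>lborel) = g (real n)" for n
  proof -
    have "(?h has_integral (g (real n) - g 0)) {0..real n}"
    proof (rule fundamental_theorem_of_calculus_interior_strong[OF fin])
      show "continuous_on {0..real n} g" by (rule continuous_on_subset[OF cont]) auto
    qed (use der in \<open>auto simp: has_real_derivative_iff_has_vector_derivative[symmetric]\<close>)
    moreover have si: "set_integrable lborel {0..real n} ?h"
      unfolding set_integrable_def using integrable_mult_indicator[OF _ int, of "{0..real n}"] by simp
    ultimately show ?thesis
      using set_borel_integral_eq_integral(2)[OF si] g0 unfolding set_lebesgue_integral_def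
      by (simp add: integral_unique)
  qed
  have "(\<lambda>n. \<integral>x. indicator {0..real n} x * ?h x \<partial>lborel) \<longlonglongrightarrow> (\<integral>x. ?h x \<partial>lborel)"
  proof (rule integral_dominated_convergence[where w = "\<lambda>x. \<bar>?h x\<bar>"])
    show "AE x in lborel. (\<lambda>n. indicator {0..real n} x * ?h x) \<longlonglongrightarrow> ?h x"
    proof (intro AE_I2)
      fix x :: real
      have "\<forall>\<^sub>F n in sequentially. indicator {0..real n} x * ?h x = ?h x"
        using eventually_ge_at_top[of "nat \<lceil>x\<rceil>"]
        by eventually_elim (auto simp: indicator_def nat_le_iff ceiling_le_iff)
      then show "(\<lambda>n. indicator {0..real n} x * ?h x) \<longlonglongrightarrow> ?h x"
        by (rule tendsto_eventually)
    qed
  qed (use int in \<open>auto simp: indicator_def borel_measurable_integrable\<close>)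
  moreover have "(\<lambda>n. g (real n)) \<longlonglongrightarrow> 0"
    using filterlim_compose[OF lim filterlim_real_sequentially] .
  ultimately show ?thesis unfolding eq using LIMSEQ_unique by blast
qed

lemma integrable_exp_half_line:
  fixes c :: real assumes "c > 0"
  shows "integrable lborel (\<lambda>x. indicator {0<..} x * exp (- c * x))"
proof -
  have "(\<lambda>x. exp (- c * x)) absolutely_integrable_on {0..}"
    by (intro nonnegative_absolutely_integrable_1 integrable_on_exp_minus_to_infinity assms) auto
  then have "integrable lborel (\<lambda>x. indicator {0..} x * exp (- c * x))"
    unfolding set_integrable_def by (subst (asm) integrable_completion) auto
  from integrable_mult_indicator[OF _ this, of "{0<..}"] show ?thesis
    by (rule Bochner_Integration.integrable_cong[THEN iffD1, rotated -1]) (auto simp: indicator_def)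
qed

text \<open>
  A polynomial factor costs only a small part of the exponential decay of the weight.
\<close>

lemma powr_le_const_exp:
  fixes m c :: real assumes "m \<ge> 0" "c > 0"
  obtains C where "C > 0" "\<And>x. x \<ge> 0 \<Longrightarrow> (1 + x) powr m \<le> C * exp (c * x)"
proof -
  \<comment> \<open>With this \<open>k\<close>, the bound \<open>m (1 + x) / k\<close> for \<open>m ln ((1 + x) / k)\<close> has slope less than \<open>c\<close>.\<close>
  define k where "k = (m + 1) / c"
  have k: "k > 0" using assms by (simp add: k_def)
  have "(1 + x) powr m \<le> exp (m * ln k + c) * exp (c * x)" if x: "x \<ge> 0" for x
  proof -
    have "ln ((1 + x) / k) \<le> (1 + x) / k"
      using x k by (intro ln_bound) auto
    then have "m * ln (1 + x) \<le> m * ln k + m * ((1 + x) / k)"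
      using x k assms(1) mult_left_mono[of "ln ((1 + x) / k)" "(1 + x) / k" m] by (simp add: ln_div algebra_simps)
    also have "m * ((1 + x) / k) \<le> c * (1 + x)"
      using x assms by (simp add: k_def divide_simps mult_right_mono)
    finally show ?thesis using x by (simp add: powr_def exp_add[symmetric] algebra_simps)
  qed
  then show ?thesis by (intro that[of "exp (m * ln k + c)"]) auto
qed

text \<open>
  Each factor of the densities is differentiated through its logarithmic derivative \<open>l\<close>, so
  that these simply add up.
\<close>

lemma has_real_derivative_prod_log:
  fixes f :: "'a \<Rightarrow> real \<Rightarrow> real"
  assumes "finite I"
    and "\<And>i. i \<in> I \<Longrightarrow> (f i has_real_derivative f i x * l i) (at x)"
  shows "((\<lambda>x. \<Prod>i\<in>I. f i x) has_real_derivative (\<Prod>i\<in>I. f i x) * (\<Sum>i\<in>I. l i)) (at x)"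
  using assms
proof (induction I)
  case (insert j I)
  have "((\<lambda>x. f j x * (\<Prod>i\<in>I. f i x)) has_real_derivative
          (f j x * l j) * (\<Prod>i\<in>I. f i x) + (\<Prod>i\<in>I. f i x) * (\<Sum>i\<in>I. l i) * f j x) (at x)"
    using insert by (intro DERIV_mult) auto
  then show ?case using insert by (simp add: algebra_simps)
qed auto

lemma nn_integral_PiM_lborel_shift:
  fixes t :: real
  assumes J: "finite J" and f: "f \<in> borel_measurable (Pi\<^sub>M J (\<lambda>_. lborel))"
  shows "(\<integral>\<^sup>+ x. f x \<partial>(Pi\<^sub>M J (\<lambda>_. lborel)))
       = (\<integral>\<^sup>+ x. f (\<lambda>j\<in>J. x j + t) \<partial>(Pi\<^sub>M J (\<lambda>_. lborel)))"
proof -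
  interpret product_sigma_finite "\<lambda>_. lborel :: real measure" ..
  let ?M = "Pi\<^sub>M J (\<lambda>_. lborel :: real measure)"
  let ?T = "\<lambda>x. \<lambda>j\<in>J. x j + t"
  have T[measurable]: "?T \<in> measurable ?M ?M" by measurable
  have "distr ?M ?M ?T = ?M"
  proof (rule PiM_eqI[OF J])
    fix A :: "'a \<Rightarrow> real set" assume A: "\<And>i. i \<in> J \<Longrightarrow> A i \<in> sets lborel"
    have "emeasure (distr ?M ?M ?T) (Pi\<^sub>E J A) = emeasure ?M (?T -` Pi\<^sub>E J A \<inter> space ?M)"
      using A J by (intro emeasure_distr) (auto intro!: sets_PiM_I_finite)
    also have "?T -` Pi\<^sub>E J A \<inter> space ?M = Pi\<^sub>E J (\<lambda>i. (\<lambda>x. x + t) -` A i)"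
      by (auto simp: space_PiM PiE_iff extensional_def)
    also have "emeasure ?M \<dots> = (\<Prod>i\<in>J. emeasure lborel ((\<lambda>x. x + t) -` A i))"
      using A J measurable_sets[of "\<lambda>x. x + t" lborel lborel] by (intro emeasure_PiM) auto
    also have "\<dots> = (\<Prod>i\<in>J. emeasure lborel (A i))"
    proof (rule prod.cong)
      fix i assume i: "i \<in> J"
      have "emeasure lborel (A i) = emeasure (distr lborel borel ((+) t)) (A i)"
        by (simp add: lborel_distr_plus)
      also have "\<dots> = emeasure lborel ((\<lambda>x. x + t) -` A i)"
        using A[OF i] by (subst emeasure_distr) (auto simp: add.commute[of _ t])
      finally show "emeasure lborel ((\<lambda>x. x + t) -` A i) = emeasure lborel (A i)" ..
    qed simp
    finally show "emeasure (distr ?M ?M ?T) (Pi\<^sub>E J A) = (\<Prod>i\<in>J. emeasure lborel (A i))" .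
  qed simp
  then show ?thesis using nn_integral_distr[OF T, of f] f by simp
qed

text \<open>
  The inequality reads \<open>(d/dt + 2b/t + K) (f' - K f) \<ge> 0\<close>. The integrating factor
  \<open>t powr (2b) exp (K t)\<close> turns this into monotonicity of \<open>\<Phi>\<close>, and the bounds at \<open>0\<close> force
  \<open>\<Phi> \<rightarrow> 0\<close> there since \<open>2b > 1\<close>. So \<open>f' \<ge> K f\<close>, and \<open>exp (- K t) f\<close> is nondecreasing.
\<close>

lemma exponential_growth_of_ode_inequality:
  fixes f f' f'' :: "real \<Rightarrow> real"
  assumes b: "b \<ge> (1::real)" and K: "K \<ge> 0"
    and f: "\<And>t. 0 < t \<Longrightarrow> (f has_real_derivative f' t) (at t)"
    and f': "\<And>t. 0 < t \<Longrightarrow> (f' has_real_derivative f'' t) (at t)"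
    and ode: "\<And>t. 0 < t \<Longrightarrow> t < s \<Longrightarrow> f'' t + (2 * b / t) * f' t \<ge> (K\<^sup>2 + 2 * b * K / t) * f t"
    and bnd: "\<And>t. 0 < t \<Longrightarrow> t \<le> 1 \<Longrightarrow> \<bar>f t\<bar> \<le> B"
    and bnd': "\<And>t. 0 < t \<Longrightarrow> t \<le> 1 \<Longrightarrow> \<bar>f' t\<bar> \<le> B / t"
    and t: "0 < t" "0 \<le> d" "t + d < s"
  shows "f t \<le> exp (- (K * d)) * f (t + d)"
proof -
  define \<Phi> where "\<Phi> t = t powr (2 * b) * exp (K * t) * (f' t - K * f t)" for t
  have \<Phi>': "(\<Phi> has_real_derivative t powr (2 * b) * exp (K * t) *
      (f'' t + (2 * b / t) * f' t - (K\<^sup>2 + 2 * b * K / t) * f t)) (at t)" if "0 < t" for t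
  proof -
    have "((\<lambda>t. t powr (2 * b)) has_real_derivative t powr (2 * b) * (2 * b / t)) (at t)"
      using has_real_derivative_powr[OF that, of "2 * b"] that by (simp add: powr_diff mult.commute)
    moreover have "((\<lambda>t. exp (K * t)) has_real_derivative exp (K * t) * K) (at t)"
      by (auto intro!: derivative_eq_intros)
    moreover have "((\<lambda>t. f' t - K * f t) has_real_derivative f'' t - K * f' t) (at t)"
      using f[OF that] f'[OF that] by (auto intro!: derivative_eq_intros)
    ultimately have "(\<Phi> has_real_derivative (t powr (2 * b) * (2 * b / t) * exp (K * t) +
        exp (K * t) * K * t powr (2 * b)) * (f' t - K * f t)
        + (f'' t - K * f' t) * (t powr (2 * b) * exp (K * t))) (at t)"
      unfolding \<Phi>_def by (intro DERIV_mult)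
    then show ?thesis
      by (rule back_subst[where P = "\<lambda>D. (\<Phi> has_real_derivative D) (at t)"])
         (simp add: algebra_simps power2_eq_square diff_divide_distrib)
  qed
  have mono: "\<Phi> u \<le> \<Phi> v" if "0 < u" "u \<le> v" "v < s" for u v
  proof (rule DERIV_nonneg_imp_nondecreasing[OF that(2)])
    fix x assume x: "u \<le> x" "x \<le> v"
    show "\<exists>y. (\<Phi> has_real_derivative y) (at x) \<and> 0 \<le> y"
      using \<Phi>'[of x] ode[of x] x that by (intro exI conjI, assumption?) auto
  qed
  have lim: "(\<Phi> \<longlongrightarrow> 0) (at_right 0)"
  proof (rule Lim_null_comparison)
    show "\<forall>\<^sub>F t in at_right 0. norm (\<Phi> t) \<le> t powr (2 * b - 1) * exp (K * t) * (B + K * B * t)"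
      using eventually_at_right_less eventually_at_right_real[OF zero_less_one]
    proof eventually_elim
      case (elim t)
      have "\<bar>f' t - K * f t\<bar> \<le> B / t + K * B"
        using bnd[of t] bnd'[of t] elim K mult_left_mono[of "\<bar>f t\<bar>" B K]
        by (intro order.trans[OF abs_triangle_ineq4] add_mono) (auto simp: abs_mult)
      then have "norm (\<Phi> t) \<le> t powr (2 * b) * exp (K * t) * (B / t + K * B)"
        unfolding \<Phi>_def by (simp add: abs_mult mult_left_mono)
      also have "\<dots> = t powr (2 * b - 1) * exp (K * t) * (B + K * B * t)"
        using elim by (simp add: powr_diff field_simps)
      finally show ?case .
    qed
    have "((\<lambda>t. t powr (2 * b - 1) * exp (K * t) * (B + K * B * t)) \<longlongrightarrow>
        0 powr (2 * b - 1) * exp (K * 0) * (B + K * B * 0)) (at_right 0)"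
      using b by (intro tendsto_intros tendsto_powr') (auto simp: eventually_at_right_less eventually_mono[OF eventually_at_right_less])
    then show "((\<lambda>t. t powr (2 * b - 1) * exp (K * t) * (B + K * B * t)) \<longlongrightarrow> 0) (at_right 0)"
      by simp
  qed
  have \<Phi>_nonneg: "\<Phi> v \<ge> 0" if v: "0 < v" "v < s" for v
  proof (rule tendsto_upperbound[OF lim])
    show "\<forall>\<^sub>F u in at_right 0. \<Phi> u \<le> \<Phi> v"
      using eventually_at_right_real[OF v(1)] by eventually_elim (use mono v in auto)
  qed simp
  have "exp (- K * t) * f t \<le> exp (- K * (t + d)) * f (t + d)"
  proof (rule DERIV_nonneg_imp_nondecreasing[of t "t + d" "\<lambda>u. exp (- K * u) * f u"])
    fix u assume u: "t \<le> u" "u \<le> t + d"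
    have "((\<lambda>u. exp (- K * u) * f u) has_real_derivative exp (- K * u) * (f' u - K * f u)) (at u)"
      using f[of u] u t by (auto intro!: derivative_eq_intros simp: algebra_simps)
    moreover have "f' u - K * f u \<ge> 0"
      using \<Phi>_nonneg[of u] u t by (simp add: \<Phi>_def zero_le_mult_iff mult_le_0_iff)
    ultimately show "\<exists>y. ((\<lambda>u. exp (- K * u) * f u) has_real_derivative y) (at u) \<and> 0 \<le> y"
      by (intro exI[of _ "exp (- K * u) * (f' u - K * f u)"]) auto
  qed (use t in auto)
  then have "exp (K * t) * (exp (- K * t) * f t) \<le> exp (K * t) * (exp (- K * (t + d)) * f (t + d))"
    by (intro mult_left_mono) auto
  moreover have "exp (K * t) * exp (- K * t) = 1"
    by (simp flip: exp_add)
  moreover have "exp (K * t) * exp (- K * (t + d)) = exp (- (K * d))"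
    unfolding exp_add[symmetric] by (rule arg_cong[where f = exp]) (simp add: algebra_simps)
  ultimately show ?thesis by (simp only: mult.assoc[symmetric] mult_1)
qed

section \<open>Pairwise repulsion\<close>

definition index_pairs :: "nat set \<Rightarrow> (nat \<times> nat) set" where
  "index_pairs J = {(j, k). j \<in> J \<and> k \<in> J \<and> j < k}"

definition repulsion :: "real \<Rightarrow> nat set \<Rightarrow> (nat \<Rightarrow> real) \<Rightarrow> real" where
  "repulsion \<beta> J y = (\<Prod>(j, k)\<in>index_pairs J. \<bar>y j - y k\<bar> powr \<beta>)"

lemma finite_index_pairs: "finite J \<Longrightarrow> finite (index_pairs J)"
  by (rule finite_subset[of _ "J \<times> J"]) (auto simp: index_pairs_def)

lemma repulsion_nonneg: "repulsion \<beta> J y \<ge> 0"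
  unfolding repulsion_def by (intro prod_nonneg) auto

lemma repulsion_insert:
  assumes "finite J" "i \<notin> J"
  shows "repulsion \<beta> (insert i J) y = repulsion \<beta> J y * (\<Prod>k\<in>J. \<bar>y i - y k\<bar> powr \<beta>)"
proof -
  let ?p = "\<lambda>k. (min i k, max i k)"
  have "q \<in> index_pairs (insert i J) \<longleftrightarrow> q \<in> index_pairs J \<union> ?p ` J" for q
  proof (cases q)
    case (Pair j k)
    have "j < k \<and> (j = i \<and> k \<in> J \<or> k = i \<and> j \<in> J) \<longleftrightarrow> (\<exists>l\<in>J. (j, k) = ?p l)"
    proof
      assume "j < k \<and> (j = i \<and> k \<in> J \<or> k = i \<and> j \<in> J)"
      then show "\<exists>l\<in>J. (j, k) = ?p l"
        by (elim conjE disjE) (rule bexI[of _ k], simp, simp, rule bexI[of _ j], simp, simp)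
    next
      assume "\<exists>l\<in>J. (j, k) = ?p l"
      then obtain l where l: "l \<in> J" "(j, k) = ?p l" by blast
      then have "l \<noteq> i" using assms by auto
      then show "j < k \<and> (j = i \<and> k \<in> J \<or> k = i \<and> j \<in> J)"
        using l by (cases "i < l") (auto simp: min_def max_def)
    qed
    then show ?thesis using assms Pair by (auto simp: index_pairs_def image_iff)
  qed
  then have split: "index_pairs (insert i J) = index_pairs J \<union> ?p ` J" by blast
  have disj: "index_pairs J \<inter> ?p ` J = {}"
    using assms by (auto simp: index_pairs_def min_def max_def split: if_splits)
  have "inj_on ?p J" by (auto simp: inj_on_def min_def max_def split: if_splits)
  then have "(\<Prod>(j, k)\<in>?p ` J. \<bar>y j - y k\<bar> powr \<beta>) = (\<Prod>k\<in>J. \<bar>y i - y k\<bar> powr \<beta>)"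
    by (subst prod.reindex) (auto simp: min_def max_def abs_minus_commute intro!: prod.cong)
  then show ?thesis unfolding repulsion_def split
    using assms disj by (subst prod.union_disjoint) (auto intro: finite_index_pairs)
qed

lemma repulsion_lessThan:
  "(\<Prod>k<n. \<Prod>j<k. \<bar>x j - x k\<bar> powr \<beta>) = repulsion \<beta> {..<n} x"
proof -
  have "(\<Prod>k<n. \<Prod>j<k. \<bar>x j - x k\<bar> powr \<beta>)
      = (\<Prod>(k, j)\<in>Sigma {..<n} (\<lambda>k. {..<k}). \<bar>x j - x k\<bar> powr \<beta>)"
    by (rule prod.Sigma) auto
  also have "\<dots> = repulsion \<beta> {..<n} x" unfolding repulsion_def
    by (rule prod.reindex_bij_witness[of _ prod.swap prod.swap]) (auto simp: index_pairs_def)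
  finally show ?thesis .
qed

lemma repulsion_eq_0:
  assumes "finite J" "\<not> inj_on y J"
  shows "repulsion \<beta> J y = 0"
proof -
  obtain j k where jk: "j \<in> J" "k \<in> J" "j \<noteq> k" "y j = y k"
    using assms(2) by (auto simp: inj_on_def)
  then have "(min j k, max j k) \<in> index_pairs J"
    by (auto simp: index_pairs_def min_def max_def)
  then show ?thesis unfolding repulsion_def using jk finite_index_pairs[OF assms(1)]
    by (intro prod_zero) (auto simp: min_def max_def intro!: bexI[of _ "(min j k, max j k)"])
qed

lemma repulsion_shift: "(\<And>j. j \<in> J \<Longrightarrow> x j = y j + t) \<Longrightarrow> repulsion \<beta> J x = repulsion \<beta> J y"
  unfolding repulsion_def by (intro prod.cong) (auto simp: index_pairs_def)

lemma repulsion_cong: "(\<And>j. j \<in> J \<Longrightarrow> x j = y j) \<Longrightarrow> repulsion \<beta> J x = repulsion \<beta> J y"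
  by (rule repulsion_shift[where t = 0]) auto

lemma repulsion_le:
  assumes J: "finite J" and b: "\<beta> \<ge> 0" and p: "p \<ge> 1" and d: "\<And>j k. j \<in> J \<Longrightarrow> k \<in> J \<Longrightarrow> \<bar>y j - y k\<bar> \<le> p"
  shows "repulsion \<beta> J y \<le> p powr (\<beta> * card (index_pairs J))"
proof -
  have "repulsion \<beta> J y \<le> (\<Prod>_\<in>index_pairs J. p powr \<beta>)" unfolding repulsion_def
    using d b by (intro prod_mono) (auto simp: index_pairs_def intro!: powr_mono2)
  then show ?thesis using p by (simp add: powr_powr[symmetric] powr_realpow)
qed

text \<open>
  Dividing by one difference lowers one exponent from \<open>\<beta>\<close> to \<open>\<beta> - 1 \<ge> 0\<close>; so the singular terms
  of the loop equations obey the same bound as the repulsion itself.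
\<close>

lemma repulsion_divide_le:
  assumes J: "finite J" and b: "\<beta> \<ge> 1" and p: "p \<ge> 1" and d: "\<And>j k. j \<in> J \<Longrightarrow> k \<in> J \<Longrightarrow> \<bar>y j - y k\<bar> \<le> p"
    and ik: "i \<in> J" "k \<in> J"
  shows "\<bar>repulsion \<beta> J y / (y i - y k)\<bar> \<le> p powr (\<beta> * card (index_pairs J))"
proof (cases "y i = y k")
  case False
  define q where "q = (min i k, max i k)"
  have "i \<noteq> k" using False by auto
  then have q: "q \<in> index_pairs J" using ik by (auto simp: q_def index_pairs_def min_def max_def)
  have fin: "finite (index_pairs J)" using finite_index_pairs[OF J] .
  have eq: "\<bar>y (fst q) - y (snd q)\<bar> = \<bar>y i - y k\<bar>" by (auto simp: q_def min_def max_def)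
  have "\<bar>repulsion \<beta> J y / (y i - y k)\<bar>
      = \<bar>y i - y k\<bar> powr \<beta> / \<bar>y i - y k\<bar> * (\<Prod>(j, k)\<in>index_pairs J - {q}. \<bar>y j - y k\<bar> powr \<beta>)"
    unfolding repulsion_def using eq
    by (subst prod.remove[OF fin q]) (simp add: abs_mult abs_prod case_prod_unfold)
  also have "\<bar>y i - y k\<bar> powr \<beta> / \<bar>y i - y k\<bar> = \<bar>y i - y k\<bar> powr (\<beta> - 1)"
    using False by (simp add: powr_diff)
  also have "\<dots> * (\<Prod>(j, k)\<in>index_pairs J - {q}. \<bar>y j - y k\<bar> powr \<beta>) \<le> p powr \<beta> * (\<Prod>_\<in>index_pairs J - {q}. p powr \<beta>)"
  proof (intro mult_mono prod_mono)
    have "\<bar>y i - y k\<bar> powr (\<beta> - 1) \<le> p powr (\<beta> - 1)"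
      using b d[OF ik] by (intro powr_mono2) auto
    also have "\<dots> \<le> p powr \<beta>" using p by (intro powr_mono) auto
    finally show "\<bar>y i - y k\<bar> powr (\<beta> - 1) \<le> p powr \<beta>" .
  qed (use b d in \<open>auto simp: index_pairs_def intro!: powr_mono2 prod_nonneg\<close>)
  also have "\<dots> = (\<Prod>_\<in>index_pairs J. p powr \<beta>)" by (rule prod.remove[OF fin q, symmetric])
  finally show ?thesis using p by (simp add: powr_powr[symmetric] powr_realpow)
qed simp

section \<open>Density of a configuration seen from its minimum\<close>

text \<open>
  \<open>J\<close> indexes the points other than the minimum, and \<open>a\<close> is the exponent of the weight.
\<close>

locale min_at_edge =
  fixes J :: "nat set" and \<beta> a :: real
  assumes J: "finite J" and \<beta>: "\<beta> \<ge> 1" and a: "a \<ge> 0"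
begin

definition \<mu> :: "(nat \<Rightarrow> real) measure" where "\<mu> = Pi\<^sub>M J (\<lambda>_. lborel)"

text \<open>
  The joint density of the minimum \<open>t\<close> and the gaps \<open>y\<close> above it: the factor \<open>y\<^sub>j\<^sup>\<beta>\<close> is the
  repulsion between the minimum and the point \<open>t + y\<^sub>j\<close>.
\<close>

definition \<omega> :: "real \<Rightarrow> (nat \<Rightarrow> real) \<Rightarrow> real" where
  "\<omega> t y = (if \<forall>j\<in>J. 0 < y j
     then t powr a * exp (- \<beta> * t / 2) * repulsion \<beta> J y *
       (\<Prod>j\<in>J. y j powr \<beta> * (t + y j) powr a * exp (- \<beta> * (t + y j) / 2))
     else 0)"

text \<open>
  Half of the exponential decay of the weight. Up to constants, locally uniform in \<open>t\<close>, it dominates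
  every integrand in the gaps that occurs below.
\<close>

definition envelope :: "(nat \<Rightarrow> real) \<Rightarrow> real" where
  "envelope y = (\<Prod>j\<in>J. indicator {0<..} (y j) * exp (- (\<beta> / 4) * y j))"

text \<open>
  The shift \<open>\<tau>\<close> plays two roles: \<open>\<tau> = t\<close> gives the sum of the inverse points themselves, and
  small \<open>\<tau> > 0\<close> regularises the case \<open>\<tau> = 0\<close>.
\<close>

definition inv_gaps :: "real \<Rightarrow> (nat \<Rightarrow> real) \<Rightarrow> real" where
  "inv_gaps \<tau> y = (\<Sum>j\<in>J. 1 / (y j + \<tau>))"

lemma component_measurable[measurable]: "j \<in> J \<Longrightarrow> (\<lambda>y. y j) \<in> borel_measurable \<mu>"
  unfolding \<mu>_def by measurable

lemma repulsion_measurable[measurable]: "repulsion \<beta> J \<in> borel_measurable \<mu>"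
proof -
  have "(\<lambda>y. \<Prod>p\<in>index_pairs J. \<bar>y (fst p) - y (snd p)\<bar> powr \<beta>) \<in> borel_measurable \<mu>"
    by (intro borel_measurable_prod) (auto simp: index_pairs_def)
  then show ?thesis by (simp add: repulsion_def[abs_def] case_prod_unfold)
qed

lemma \<omega>_measurable[measurable]: "\<omega> t \<in> borel_measurable \<mu>"
proof -
  have [measurable]: "Measurable.pred \<mu> (\<lambda>y. \<forall>j\<in>J. 0 < y j)"
    using J by measurable
  show ?thesis unfolding \<omega>_def[abs_def] by measurable
qed

lemma inv_gaps_measurable[measurable]: "inv_gaps \<tau> \<in> borel_measurable \<mu>"
  unfolding inv_gaps_def[abs_def] by measurable

lemma \<omega>_nonneg: "\<omega> t y \<ge> 0"
  unfolding \<omega>_def by (auto intro!: mult_nonneg_nonneg prod_nonneg repulsion_nonneg)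

lemma \<omega>_ties: "\<not> inj_on y J \<Longrightarrow> \<omega> t y = 0"
  unfolding \<omega>_def using repulsion_eq_0[OF J] by auto

lemma envelope_nonneg: "envelope y \<ge> 0" unfolding envelope_def by (intro prod_nonneg) auto

lemma integrable_envelope: "integrable \<mu> envelope"
proof -
  interpret product_sigma_finite "\<lambda>_. lborel :: real measure" ..
  show ?thesis unfolding \<mu>_def envelope_def[abs_def]
    using \<beta> J by (intro product_integrable_prod integrable_exp_half_line) auto
qed

lemma integrable_dominated:
  assumes "h \<in> borel_measurable \<mu>" "\<And>y. \<bar>h y\<bar> \<le> B * envelope y"
  shows "integrable \<mu> h"
  by (rule Bochner_Integration.integrable_bound[OF integrable_mult_right[OF integrable_envelope, of B]])
     (use assms in \<open>auto intro: order.trans[OF _ abs_ge_self]\<close>)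

text \<open>
  Everything is compared with \<open>p = \<Prod> (1 + y\<^sub>j)\<close>, which dominates all gaps and all differences of
  gaps. Division by a gap or by a difference only lowers an exponent \<open>\<beta>\<close> to \<open>\<beta> - 1 \<ge> 0\<close>.
\<close>

lemma \<omega>_bounds:
  assumes T: "T > 0"
  obtains B where "B \<ge> 0"
    "\<And>t y. 0 < t \<Longrightarrow> t \<le> T \<Longrightarrow> \<bar>\<omega> t y\<bar> \<le> B * envelope y"
    "\<And>t y i. 0 < t \<Longrightarrow> t \<le> T \<Longrightarrow> i \<in> J \<Longrightarrow> \<bar>\<omega> t y / y i\<bar> \<le> B * envelope y"
    "\<And>t y i k. 0 < t \<Longrightarrow> t \<le> T \<Longrightarrow> i \<in> J \<Longrightarrow> k \<in> J \<Longrightarrow> \<bar>\<omega> t y / (y i - y k)\<bar> \<le> B * envelope y"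
proof -
  define m where "m = \<beta> * card (index_pairs J)"
  have m: "m \<ge> 0" using \<beta> by (simp add: m_def)
  obtain C where C: "C > 0" "\<And>x. x \<ge> 0 \<Longrightarrow> (1 + x) powr (m + \<beta> + a) \<le> C * exp (\<beta> / 4 * x)"
    using powr_le_const_exp[of "m + \<beta> + a" "\<beta> / 4"] m \<beta> a by auto
  define B where "B = T powr a * (\<Prod>j\<in>J. (1 + T) powr a * C)"
  have B: "B \<ge> 0" using C by (auto simp: B_def intro!: mult_nonneg_nonneg prod_nonneg)
  have key: "\<bar>\<omega> t y\<bar> \<le> B * envelope y \<and> (\<forall>i\<in>J. \<bar>\<omega> t y / y i\<bar> \<le> B * envelope y) \<and>
      (\<forall>i\<in>J. \<forall>k\<in>J. \<bar>\<omega> t y / (y i - y k)\<bar> \<le> B * envelope y)" if t: "0 < t" "t \<le> T" for t y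
  proof (cases "\<forall>j\<in>J. 0 < y j")
    case False
    then have "\<omega> t y = 0" unfolding \<omega>_def by (rule if_not_P)
    then show ?thesis using B envelope_nonneg by simp
  next
    case pos: True
    define p where "p = (\<Prod>j\<in>J. 1 + y j)"
    have p1: "p \<ge> 1" unfolding p_def using pos by (intro prod_ge_1) (auto simp: less_imp_le)
    have p: "1 + y j \<le> p" if "j \<in> J" for j
    proof -
      have "(\<Prod>j\<in>J - {j}. 1 + y j) \<ge> 1" using pos by (intro prod_ge_1) (auto simp: less_imp_le)
      moreover have "p = (1 + y j) * (\<Prod>j\<in>J - {j}. 1 + y j)"
        unfolding p_def by (rule prod.remove[OF J that])
      moreover have "1 + y j > 0" using pos that by (auto intro: add_pos_pos)
      ultimately show ?thesis by simp
    qed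
    have gap: "\<bar>y j - y k\<bar> \<le> p" if "j \<in> J" "k \<in> J" for j k
    proof -
      have "0 < y j" "0 < y k" using pos that by auto
      then show ?thesis using p[OF that(1)] p[OF that(2)] by linarith
    qed
    define Y where "Y = (\<Prod>j\<in>J. y j powr \<beta>)"
    define X where "X = (\<Prod>j\<in>J. (t + y j) powr a * exp (- \<beta> * (t + y j) / 2))"
    have \<omega>: "\<omega> t y = t powr a * exp (- \<beta> * t / 2) * repulsion \<beta> J y * (Y * X)"
      using pos by (simp add: \<omega>_def Y_def X_def prod.distrib mult.assoc)
    have p_powr: "p powr r = (\<Prod>j\<in>J. (1 + y j) powr r)" for r
      unfolding p_def by (rule prod_powr_distrib)
    have Y: "\<bar>Y\<bar> \<le> p powr \<beta>"
      unfolding p_powr Y_def abs_prod using \<beta> pos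
      by (intro prod_mono) (auto intro!: powr_mono2 simp: less_imp_le)
    have Y': "\<bar>Y / y i\<bar> \<le> p powr \<beta>" if i: "i \<in> J" for i
    proof -
      have yi: "y i > 0" using pos i by auto
      have "\<bar>Y / y i\<bar> = y i powr (\<beta> - 1) * (\<Prod>j\<in>J - {i}. y j powr \<beta>)"
        unfolding Y_def using yi
        by (subst prod.remove[OF J i]) (simp add: abs_mult abs_prod powr_diff)
      also have "\<dots> \<le> (1 + y i) powr \<beta> * (\<Prod>j\<in>J - {i}. (1 + y j) powr \<beta>)"
      proof (intro mult_mono prod_mono)
        have "y i powr (\<beta> - 1) \<le> (1 + y i) powr (\<beta> - 1)" using yi \<beta> by (intro powr_mono2) auto
        also have "\<dots> \<le> (1 + y i) powr \<beta>" using yi by (intro powr_mono) auto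
        finally show "y i powr (\<beta> - 1) \<le> (1 + y i) powr \<beta>" .
      qed (use \<beta> pos in \<open>auto intro!: powr_mono2 prod_nonneg simp: less_imp_le\<close>)
      also have "\<dots> = p powr \<beta>" unfolding p_powr by (rule prod.remove[OF J i, symmetric])
      finally show ?thesis .
    qed
    have X: "p powr (m + \<beta>) * \<bar>X\<bar> \<le> (\<Prod>j\<in>J. (1 + T) powr a * C) * envelope y"
      unfolding p_powr X_def abs_prod envelope_def prod.distrib[symmetric]
    proof (intro prod_mono conjI)
      fix j assume j: "j \<in> J"
      have yj: "y j > 0" using pos j by auto
      have "(t + y j) powr a \<le> ((1 + T) * (1 + y j)) powr a"
      proof (intro powr_mono2)
        have "(1 + T) * (1 + y j) = 1 + T + y j + T * y j" by (simp add: algebra_simps)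
        with t mult_pos_pos[OF T yj] show "t + y j \<le> (1 + T) * (1 + y j)" by linarith
      qed (use t yj a in auto)
      also have "\<dots> = (1 + T) powr a * (1 + y j) powr a" using yj T by (intro powr_mult)
      finally have 1: "(t + y j) powr a \<le> (1 + T) powr a * (1 + y j) powr a" .
      have 2: "exp (- \<beta> * (t + y j) / 2) \<le> exp (- (\<beta> / 2) * y j)"
        using \<beta> t by (simp add: algebra_simps)
      have "(1 + y j) powr (m + \<beta>) * \<bar>(t + y j) powr a * exp (- \<beta> * (t + y j) / 2)\<bar>
         \<le> (1 + y j) powr (m + \<beta>) * ((1 + T) powr a * (1 + y j) powr a * exp (- (\<beta> / 2) * y j))"
        using 1 2 by (intro mult_left_mono) (auto simp: abs_mult intro!: mult_mono)
      also have "\<dots> = (1 + T) powr a * (1 + y j) powr (m + \<beta> + a) * exp (- (\<beta> / 2) * y j)"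
        by (simp add: powr_add)
      also have "\<dots> \<le> (1 + T) powr a * (C * exp (\<beta> / 4 * y j)) * exp (- (\<beta> / 2) * y j)"
        using C(2)[of "y j"] yj by (intro mult_right_mono mult_left_mono) auto
      also have "\<dots> = (1 + T) powr a * C * (indicator {0<..} (y j) * exp (- (\<beta> / 4) * y j))"
        using yj by (simp add: mult.assoc exp_add[symmetric])
      finally show "(1 + y j) powr (m + \<beta>) * \<bar>(t + y j) powr a * exp (- \<beta> * (t + y j) / 2)\<bar>
         \<le> (1 + T) powr a * C * (indicator {0<..} (y j) * exp (- (\<beta> / 4) * y j))" .
    qed auto
    have t': "t powr a * exp (- \<beta> * t / 2) \<le> T powr a"
    proof -
      have "t powr a * exp (- \<beta> * t / 2) \<le> T powr a * 1"
        using t a \<beta> by (intro mult_mono powr_mono2) auto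
      then show ?thesis by simp
    qed
    have comb: "\<bar>t powr a * exp (- \<beta> * t / 2) * r * (z * X)\<bar> \<le> B * envelope y"
      if "\<bar>r\<bar> \<le> p powr m" "\<bar>z\<bar> \<le> p powr \<beta>" for r z
    proof -
      have "\<bar>t powr a * exp (- \<beta> * t / 2) * r * (z * X)\<bar>
          = (t powr a * exp (- \<beta> * t / 2)) * \<bar>r\<bar> * (\<bar>z\<bar> * \<bar>X\<bar>)" by (simp add: abs_mult)
      also have "\<dots> \<le> T powr a * p powr m * (p powr \<beta> * \<bar>X\<bar>)"
        using that t' by (intro mult_mono) auto
      also have "\<dots> = T powr a * (p powr (m + \<beta>) * \<bar>X\<bar>)" by (simp add: powr_add)
      also have "\<dots> \<le> T powr a * ((\<Prod>j\<in>J. (1 + T) powr a * C) * envelope y)"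
        using X by (intro mult_left_mono) auto
      finally show ?thesis by (simp add: B_def mult.assoc)
    qed
    have R: "\<bar>repulsion \<beta> J y\<bar> \<le> p powr m"
      using repulsion_le[OF J _ p1 gap, of \<beta>] \<beta> repulsion_nonneg[of \<beta> J y] by (simp add: m_def)
    have R': "\<bar>repulsion \<beta> J y / (y i - y k)\<bar> \<le> p powr m" if "i \<in> J" "k \<in> J" for i k
      unfolding m_def using that by (intro repulsion_divide_le[OF J \<beta> p1 gap])
    show ?thesis
    proof (intro conjI ballI)
      show "\<bar>\<omega> t y\<bar> \<le> B * envelope y" unfolding \<omega> using R Y by (rule comb)
      show "\<bar>\<omega> t y / y i\<bar> \<le> B * envelope y" if "i \<in> J" for i
        using comb[OF R Y'[OF that]] by (simp add: \<omega>)
      show "\<bar>\<omega> t y / (y i - y k)\<bar> \<le> B * envelope y" if "i \<in> J" "k \<in> J" for i k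
        using comb[OF R'[OF that] Y] by (simp add: \<omega>)
    qed
  qed
  show ?thesis by (rule that[OF B]) (use key in blast)+
qed

section \<open>Loop equations for the gaps\<close>

text \<open>
  The logarithmic derivative of \<open>\<omega>\<close> in the gap \<open>y\<^sub>j\<close>. The term \<open>k = j\<close> of the sum is \<open>1 / 0 = 0\<close>.
\<close>

definition gap_score :: "real \<Rightarrow> nat \<Rightarrow> (nat \<Rightarrow> real) \<Rightarrow> real" where
  "gap_score t j y = \<beta> / y j + a / (t + y j) - \<beta> / 2 + \<beta> * (\<Sum>k\<in>J. 1 / (y j - y k))"

lemma gap_score_measurable[measurable]: "j \<in> J \<Longrightarrow> gap_score t j \<in> borel_measurable \<mu>"
  unfolding gap_score_def[abs_def] by measurable

text \<open>
  The integrand is the derivative of \<open>v \<omega>\<close> in the gap \<open>y\<^sub>j\<close>. By Fubini it suffices to integrate it over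
  \<open>y\<^sub>j \<in> (0, \<infinity>)\<close>; \<open>v \<omega>\<close> vanishes at both ends because of the factor \<open>y\<^sub>j\<^sup>\<beta>\<close> and the exponential decay.
\<close>

lemma loop_equation:
  assumes t: "t > 0" and j: "j \<in> J"
    and meas[measurable]: "v \<in> borel_measurable \<mu>" "v' \<in> borel_measurable \<mu>"
    and bnd: "\<And>y. \<forall>k\<in>J. 0 < y k \<Longrightarrow> \<bar>v y\<bar> \<le> B" "\<And>y. \<forall>k\<in>J. 0 < y k \<Longrightarrow> \<bar>v' y\<bar> \<le> B"
    and der: "\<And>y z. \<forall>k\<in>J-{j}. 0 < y k \<Longrightarrow> 0 < z \<Longrightarrow>
        ((\<lambda>z. v (y(j := z))) has_real_derivative v' (y(j := z))) (at z)"
    and cont: "\<And>y. \<forall>k\<in>J-{j}. 0 < y k \<Longrightarrow> continuous_on {0..} (\<lambda>z. v (y(j := z)))"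
  shows "integrable \<mu> (\<lambda>y. (v' y + v y * gap_score t j y) * \<omega> t y)"
    and "(\<integral>y. (v' y + v y * gap_score t j y) * \<omega> t y \<partial>\<mu>) = 0"
proof -
  let ?J = "J - {j}"
  let ?N = "real (card J)"
  define H where "H y = (v' y + v y * gap_score t j y) * \<omega> t y" for y
  have Jins: "insert j ?J = J" and finJ: "finite ?J" using j J by auto
  have B: "B \<ge> 0" using bnd(1)[of "\<lambda>_. 1"] by auto
  obtain B0 where B0: "B0 \<ge> 0" "\<And>y. \<bar>\<omega> t y\<bar> \<le> B0 * envelope y" "\<And>y i. i \<in> J \<Longrightarrow> \<bar>\<omega> t y / y i\<bar> \<le> B0 * envelope y"
      "\<And>y i k. i \<in> J \<Longrightarrow> k \<in> J \<Longrightarrow> \<bar>\<omega> t y / (y i - y k)\<bar> \<le> B0 * envelope y"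
    using \<omega>_bounds[OF t] t by (metis order_refl)
  define B1 where "B1 = B * (1 + (\<beta> + a / t + \<beta> / 2 + \<beta> * ?N)) * B0"
  have gap_score_bnd: "\<bar>gap_score t j y * \<omega> t y\<bar> \<le> (\<beta> + a / t + \<beta> / 2 + \<beta> * ?N) * (B0 * envelope y)"
    if pos: "\<forall>k\<in>J. 0 < y k" for y
  proof -
    have yj: "y j > 0" using pos j by auto
    have eq: "gap_score t j y * \<omega> t y = \<beta> * (\<omega> t y / y j) + a / (t + y j) * \<omega> t y - \<beta> / 2 * \<omega> t y
        + \<beta> * (\<Sum>k\<in>J. \<omega> t y / (y j - y k))"
      by (simp add: gap_score_def algebra_simps sum_distrib_left)
    have 1: "\<bar>\<beta> * (\<omega> t y / y j)\<bar> \<le> \<beta> * (B0 * envelope y)"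
      using B0(3)[OF j, of y] \<beta> mult_left_mono[of "\<bar>\<omega> t y / y j\<bar>" "B0 * envelope y" \<beta>] by (simp add: abs_mult)
    have "\<bar>a / (t + y j) * \<omega> t y\<bar> = a / (t + y j) * \<bar>\<omega> t y\<bar>" using a t yj by (simp add: abs_mult)
    also have "\<dots> \<le> a / t * (B0 * envelope y)"
      using a t yj B0(2)[of y] by (intro mult_mono divide_left_mono) auto
    finally have 2: "\<bar>a / (t + y j) * \<omega> t y\<bar> \<le> a / t * (B0 * envelope y)" .
    have 3: "\<bar>\<beta> / 2 * \<omega> t y\<bar> \<le> \<beta> / 2 * (B0 * envelope y)"
      using B0(2)[of y] \<beta> mult_left_mono[of "\<bar>\<omega> t y\<bar>" "B0 * envelope y" "\<beta> / 2"] by (simp add: abs_mult)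
    have "\<bar>\<Sum>k\<in>J. \<omega> t y / (y j - y k)\<bar> \<le> (\<Sum>k\<in>J. B0 * envelope y)"
      using B0(4)[OF j, of _ y] by (intro order.trans[OF sum_abs] sum_mono) auto
    then have 4: "\<bar>\<beta> * (\<Sum>k\<in>J. \<omega> t y / (y j - y k))\<bar> \<le> \<beta> * ?N * (B0 * envelope y)"
      using \<beta> mult_left_mono[of "\<bar>\<Sum>k\<in>J. \<omega> t y / (y j - y k)\<bar>" "?N * (B0 * envelope y)" \<beta>]
      by (simp add: abs_mult mult.assoc)
    show ?thesis unfolding eq distrib_right using 1 2 3 4 by linarith
  qed
  have Hb: "\<bar>H y\<bar> \<le> B1 * envelope y" for y
  proof (cases "\<forall>k\<in>J. 0 < y k")
    case True
    have "\<bar>H y\<bar> \<le> \<bar>v' y\<bar> * \<bar>\<omega> t y\<bar> + \<bar>v y\<bar> * \<bar>gap_score t j y * \<omega> t y\<bar>"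
      unfolding H_def distrib_right abs_mult[symmetric] mult.assoc by (rule abs_triangle_ineq)
    also have "\<dots> \<le> B * (B0 * envelope y) + B * ((\<beta> + a / t + \<beta> / 2 + \<beta> * ?N) * (B0 * envelope y))"
      using bnd[OF True] B0(2)[of y] gap_score_bnd[OF True] B by (intro add_mono mult_mono) auto
    also have "\<dots> = B1 * envelope y" by (simp add: B1_def algebra_simps)
    finally show ?thesis .
  next
    case False
    then have "\<omega> t y = 0" unfolding \<omega>_def by (rule if_not_P)
    moreover have "B1 \<ge> 0" using B B0(1) \<beta> a t by (auto simp: B1_def intro!: mult_nonneg_nonneg add_nonneg_nonneg)
    ultimately show ?thesis using envelope_nonneg[of y] by (simp add: H_def)
  qed
  have Hm[measurable]: "H \<in> borel_measurable \<mu>" unfolding H_def[abs_def] using j by measurable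
  have Hi: "integrable \<mu> H" by (rule integrable_dominated[OF Hm Hb])
  then show "integrable \<mu> (\<lambda>y. (v' y + v y * gap_score t j y) * \<omega> t y)" by (simp add: H_def[abs_def])
  interpret product_sigma_finite "\<lambda>_. lborel :: real measure" ..
  have inner: "(\<integral>z. H (x(j := z)) \<partial>lborel) = 0" if x: "x \<in> space (Pi\<^sub>M ?J (\<lambda>_. lborel))" for x
  proof (cases "\<forall>k\<in>?J. 0 < x k")
    case False
    then have "\<omega> t (x(j := z)) = 0" for z unfolding \<omega>_def by (subst if_not_P) auto
    then show ?thesis by (simp add: H_def)
  next
    case pos: True
    define c where "c = t powr a * exp (- \<beta> * t / 2) * repulsion \<beta> ?J x *
       (\<Prod>k\<in>?J. x k powr \<beta> * (t + x k) powr a * exp (- \<beta> * (t + x k) / 2))"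
    define \<Omega> where "\<Omega> z = c * ((\<Prod>k\<in>?J. \<bar>z - x k\<bar> powr \<beta>) * (z powr \<beta> * ((t + z) powr a * exp (- \<beta> * (t + z) / 2))))" for z
    have \<omega>\<Omega>: "\<omega> t (x(j := z)) = \<Omega> z" if "z > 0" for z
    proof -
      have "repulsion \<beta> J (x(j := z)) = repulsion \<beta> ?J x * (\<Prod>k\<in>?J. \<bar>z - x k\<bar> powr \<beta>)"
      proof -
        have "repulsion \<beta> (insert j ?J) (x(j := z)) = repulsion \<beta> ?J (x(j := z)) * (\<Prod>k\<in>?J. \<bar>z - x k\<bar> powr \<beta>)"
          by (subst repulsion_insert[OF finJ]) (auto intro!: prod.cong)
        moreover have "repulsion \<beta> ?J (x(j := z)) = repulsion \<beta> ?J x" by (rule repulsion_cong) auto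
        ultimately show ?thesis by (simp only: Jins)
      qed
      moreover have "(\<Prod>k\<in>J. (x(j := z)) k powr \<beta> * (t + (x(j := z)) k) powr a * exp (- \<beta> * (t + (x(j := z)) k) / 2))
         = z powr \<beta> * (t + z) powr a * exp (- \<beta> * (t + z) / 2) *
            (\<Prod>k\<in>?J. x k powr \<beta> * (t + x k) powr a * exp (- \<beta> * (t + x k) / 2))"
        by (subst prod.remove[OF J j]) (auto intro!: prod.cong)
      moreover have "\<forall>k\<in>J. 0 < (x(j := z)) k" using pos that by auto
      ultimately show ?thesis unfolding \<omega>_def \<Omega>_def c_def by (simp add: mult_ac)
    qed
    have \<omega>0: "\<omega> t (x(j := z)) = 0" if "z \<le> 0" for z
      unfolding \<omega>_def using that j by (subst if_not_P) (auto intro!: bexI[of _ j])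
    define g where "g z = v (x(j := z)) * \<Omega> z" for z
    define g' where "g' z = (v' (x(j := z)) + v (x(j := z)) * gap_score t j (x(j := z))) * \<Omega> z" for z
    have Hg: "H (x(j := z)) = indicator {0<..} z * g' z" for z
      by (cases "z > 0") (simp_all add: H_def g'_def \<omega>\<Omega> \<omega>0)
    define Dx where "Dx = (\<Prod>k\<in>?J. indicator {0<..} (x k) * exp (- (\<beta> / 4) * x k) :: real)"
    have Dx: "envelope (x(j := z)) = Dx * (indicator {0<..} z * exp (- (\<beta> / 4) * z))" for z
    proof -
      have "(\<Prod>k\<in>?J. indicator {0<..} ((x(j := z)) k) * exp (- (\<beta> / 4) * (x(j := z)) k)) = Dx"
        unfolding Dx_def by (rule prod.cong) auto
      then show ?thesis unfolding envelope_def by (subst prod.remove[OF J j]) simp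
    qed
    have sx: "(\<lambda>z. x(j := z)) \<in> measurable lborel \<mu>"
      using measurable_component_update[OF x, of j] unfolding \<mu>_def Jins by simp
    have "integrable lborel (\<lambda>z. H (x(j := z)))"
    proof (rule Bochner_Integration.integrable_bound)
      show "integrable lborel (\<lambda>z. B1 * (Dx * (indicator {0<..} z * exp (- (\<beta> / 4) * z))))"
        using \<beta> by (intro integrable_mult_right integrable_exp_half_line) auto
      show "(\<lambda>z. H (x(j := z))) \<in> borel_measurable lborel" using measurable_compose[OF sx Hm] .
      show "AE z in lborel. norm (H (x(j := z))) \<le> norm (B1 * (Dx * (indicator {0<..} z * exp (- (\<beta> / 4) * z))))"
        using Hb unfolding Dx[symmetric] by (auto intro: order.trans[OF _ abs_ge_self])
    qed
    then have int: "integrable lborel (\<lambda>z. indicator {0<..} z * g' z)" by (simp add: Hg)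
    have "(\<integral>z. indicator {0<..} z * g' z \<partial>lborel) = 0"
    proof (rule integral_derivative_eq_0[OF _ _ _ _ _ int])
      show "continuous_on {0..} g" unfolding g_def \<Omega>_def using \<beta> a t
        by (intro continuous_intros cont[OF pos] continuous_on_powr') auto
      show "g 0 = 0" using \<beta> by (simp add: g_def \<Omega>_def)
      show "finite (x ` ?J)" using finJ by simp
      show "(g \<longlongrightarrow> 0) at_top"
      proof (rule Lim_null_comparison)
        show "\<forall>\<^sub>F z in at_top. norm (g z) \<le> B * (B0 * (Dx * exp (- (\<beta> / 4) * z)))"
          using eventually_gt_at_top[of 0]
        proof eventually_elim
          case (elim z)
          have "\<bar>g z\<bar> = \<bar>v (x(j := z))\<bar> * \<bar>\<omega> t (x(j := z))\<bar>" by (simp add: g_def \<omega>\<Omega>[OF elim] abs_mult)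
          also have "\<dots> \<le> B * (B0 * envelope (x(j := z)))"
            using pos elim B by (intro mult_mono bnd B0(2)) auto
          finally show ?case using elim by (simp add: Dx)
        qed
        have "((\<lambda>z. B * (B0 * (Dx * exp (- (\<beta> / 4) * z)))) \<longlongrightarrow> B * (B0 * (Dx * 0))) at_top"
        proof (intro tendsto_intros filterlim_compose[OF exp_at_bot])
          show "filterlim (\<lambda>z. - (\<beta> / 4) * z) at_bot at_top"
            using \<beta> by (intro filterlim_tendsto_neg_mult_at_bot[OF tendsto_const _ filterlim_ident]) auto
        qed
        then show "((\<lambda>z. B * (B0 * (Dx * exp (- (\<beta> / 4) * z)))) \<longlongrightarrow> 0) at_top" by simp
      qed
      fix z assume z: "0 < z" "z \<notin> x ` ?J"
      have "((\<lambda>z. \<Prod>k\<in>?J. \<bar>z - x k\<bar> powr \<beta>) has_real_derivative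
          (\<Prod>k\<in>?J. \<bar>z - x k\<bar> powr \<beta>) * (\<Sum>k\<in>?J. \<beta> / (z - x k))) (at z)"
      proof (rule has_real_derivative_prod_log[OF finJ])
        fix k assume k: "k \<in> ?J"
        then have ne: "z - x k \<noteq> 0" using z by auto
        show "((\<lambda>z. \<bar>z - x k\<bar> powr \<beta>) has_real_derivative \<bar>z - x k\<bar> powr \<beta> * (\<beta> / (z - x k))) (at z)"
        proof (cases "z - x k > 0")
          case True
          have "((\<lambda>z. (z - x k) powr \<beta>) has_real_derivative \<beta> * (z - x k) powr (\<beta> - 1) * 1) (at z)"
            by (rule DERIV_chain2[where f = "\<lambda>u. u powr \<beta>" and g = "\<lambda>z. z - x k", OF has_real_derivative_powr[OF True]])
               (auto intro!: derivative_eq_intros)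
          then have "((\<lambda>z. (z - x k) powr \<beta>) has_real_derivative \<bar>z - x k\<bar> powr \<beta> * (\<beta> / (z - x k))) (at z)"
            using True by (simp add: powr_diff mult.commute)
          then show ?thesis
            by (rule has_field_derivative_transform_within_open[of _ _ _ "{x k<..}"]) (use True in auto)
        next
          case False
          then have neg: "x k - z > 0" using ne by simp
          have "((\<lambda>z. (x k - z) powr \<beta>) has_real_derivative \<beta> * (x k - z) powr (\<beta> - 1) * (- 1)) (at z)"
            by (rule DERIV_chain2[where f = "\<lambda>u. u powr \<beta>" and g = "\<lambda>z. x k - z", OF has_real_derivative_powr[OF neg]])
               (auto intro!: derivative_eq_intros)
          moreover have "\<beta> * (x k - z) powr (\<beta> - 1) * (- 1) = \<bar>z - x k\<bar> powr \<beta> * (\<beta> / (z - x k))"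
            using neg ne by (simp add: powr_diff field_simps)
          ultimately have "((\<lambda>z. (x k - z) powr \<beta>) has_real_derivative \<bar>z - x k\<bar> powr \<beta> * (\<beta> / (z - x k))) (at z)"
            by simp
          then show ?thesis
            by (rule has_field_derivative_transform_within_open[of _ _ _ "{..<x k}"]) (use neg in auto)
        qed
      qed
      moreover have "((\<lambda>z. z powr \<beta>) has_real_derivative z powr \<beta> * (\<beta> / z)) (at z)"
        using has_real_derivative_powr[OF z(1), of \<beta>] z by (simp add: powr_diff mult.commute)
      moreover have "((\<lambda>z. (t + z) powr a) has_real_derivative (t + z) powr a * (a / (t + z))) (at z)"
      proof -
        have tz: "t + z > 0" using t z by simp
        have "((\<lambda>z. (t + z) powr a) has_real_derivative a * (t + z) powr (a - 1) * 1) (at z)"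
          by (rule DERIV_chain2[where f = "\<lambda>u. u powr a" and g = "\<lambda>z. t + z", OF has_real_derivative_powr[OF tz]])
             (auto intro!: derivative_eq_intros)
        then show ?thesis using tz by (simp add: powr_diff mult.commute)
      qed
      moreover have "((\<lambda>z. exp (- \<beta> * (t + z) / 2)) has_real_derivative exp (- \<beta> * (t + z) / 2) * (- \<beta> / 2)) (at z)"
        by (auto intro!: derivative_eq_intros)
      moreover note der[OF pos z(1)]
      ultimately have g: "(g has_real_derivative
          v' (x(j := z)) * \<Omega> z + 
          (c * (((\<Prod>k\<in>?J. \<bar>z - x k\<bar> powr \<beta>) * (\<Sum>k\<in>?J. \<beta> / (z - x k))) * (z powr \<beta> * ((t + z) powr a * exp (- \<beta> * (t + z) / 2))) +
            (z powr \<beta> * (\<beta> / z) * ((t + z) powr a * exp (- \<beta> * (t + z) / 2)) +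
              ((t + z) powr a * (a / (t + z)) * exp (- \<beta> * (t + z) / 2) + exp (- \<beta> * (t + z) / 2) * (- \<beta> / 2) * (t + z) powr a) * z powr \<beta>)
              * (\<Prod>k\<in>?J. \<bar>z - x k\<bar> powr \<beta>))) * v (x(j := z))) (at z)"
        unfolding g_def \<Omega>_def by (intro DERIV_mult DERIV_cmult)
      have sc: "gap_score t j (x(j := z)) = \<beta> / z + a / (t + z) - \<beta> / 2 + (\<Sum>k\<in>?J. \<beta> / (z - x k))"
      proof -
        have "(\<Sum>k\<in>J. 1 / ((x(j := z)) j - (x(j := z)) k)) = (\<Sum>k\<in>?J. 1 / (z - x k))"
          by (subst sum.remove[OF J j]) (auto intro!: sum.cong)
        then show ?thesis by (simp add: gap_score_def sum_distrib_left)
      qed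
      show "(g has_real_derivative g' z) (at z)"
        by (rule back_subst[where P = "\<lambda>D. (g has_real_derivative D) (at z)", OF g])
           (simp add: g'_def \<Omega>_def sc algebra_simps)
    qed
    then show ?thesis by (simp add: Hg)
  qed
  have "integral\<^sup>L \<mu> H = (\<integral>x. (\<integral>z. H (x(j := z)) \<partial>lborel) \<partial>Pi\<^sub>M ?J (\<lambda>_. lborel))"
    using product_integral_insert[of ?J j H] finJ Hi unfolding \<mu>_def Jins by simp
  also have "\<dots> = (\<integral>x. 0 \<partial>Pi\<^sub>M ?J (\<lambda>_. lborel :: real measure))"
    using inner by (intro Bochner_Integration.integral_cong refl)
  finally show "(\<integral>y. (v' y + v y * gap_score t j y) * \<omega> t y \<partial>\<mu>) = 0" by (simp add: H_def[abs_def])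
qed

text \<open>
  The divergence form for a vector field \<open>v\<close>. Collisions may be excluded in \<open>eq\<close> because \<open>\<omega>\<close> vanishes
  there.
\<close>

lemma summed_loop_equation:
  assumes t: "t > 0"
    and meas: "\<And>j. j \<in> J \<Longrightarrow> v j \<in> borel_measurable \<mu>" "\<And>j. j \<in> J \<Longrightarrow> v' j \<in> borel_measurable \<mu>"
    and bnd: "\<And>j y. j \<in> J \<Longrightarrow> \<forall>k\<in>J. 0 < y k \<Longrightarrow> \<bar>v j y\<bar> \<le> B" 
      "\<And>j y. j \<in> J \<Longrightarrow> \<forall>k\<in>J. 0 < y k \<Longrightarrow> \<bar>v' j y\<bar> \<le> B"
    and der: "\<And>j y z. j \<in> J \<Longrightarrow> \<forall>k\<in>J-{j}. 0 < y k \<Longrightarrow> 0 < z \<Longrightarrow>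
        ((\<lambda>z. v j (y(j := z))) has_real_derivative v' j (y(j := z))) (at z)"
    and cont: "\<And>j y. j \<in> J \<Longrightarrow> \<forall>k\<in>J-{j}. 0 < y k \<Longrightarrow> continuous_on {0..} (\<lambda>z. v j (y(j := z)))"
    and eq: "\<And>y. \<forall>k\<in>J. 0 < y k \<Longrightarrow> inj_on y J \<Longrightarrow> (\<Sum>j\<in>J. v' j y + v j y * gap_score t j y) = L y"
  shows "integrable \<mu> (\<lambda>y. L y * \<omega> t y)" "(\<integral>y. L y * \<omega> t y \<partial>\<mu>) = 0"
proof -
  have L: "(\<lambda>y. L y * \<omega> t y) = (\<lambda>y. \<Sum>j\<in>J. (v' j y + v j y * gap_score t j y) * \<omega> t y)"
  proof
    fix y show "L y * \<omega> t y = (\<Sum>j\<in>J. (v' j y + v j y * gap_score t j y) * \<omega> t y)"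
    proof (cases "(\<forall>k\<in>J. 0 < y k) \<and> inj_on y J")
      case True then show ?thesis using eq[of y] by (simp add: sum_distrib_right[symmetric])
    next
      case False
      then have "\<omega> t y = 0" using \<omega>_ties[of y t] unfolding \<omega>_def by (metis if_not_P)
      then show ?thesis by simp
    qed
  qed
  have *: "integrable \<mu> (\<lambda>y. (v' j y + v j y * gap_score t j y) * \<omega> t y)
      \<and> (\<integral>y. (v' j y + v j y * gap_score t j y) * \<omega> t y \<partial>\<mu>) = 0" if j: "j \<in> J" for j
  proof
    show "integrable \<mu> (\<lambda>y. (v' j y + v j y * gap_score t j y) * \<omega> t y)"
      by (rule loop_equation(1)[where v = "v j" and v' = "v' j" and t = t and j = j and B = B])
         (rule t j meas bnd der cont; (rule j | assumption))+
    show "(\<integral>y. (v' j y + v j y * gap_score t j y) * \<omega> t y \<partial>\<mu>) = 0"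
      by (rule loop_equation(2)[where v = "v j" and v' = "v' j" and t = t and j = j and B = B])
         (rule t j meas bnd der cont; (rule j | assumption))+
  qed
  show "integrable \<mu> (\<lambda>y. L y * \<omega> t y)" unfolding L
    by (rule Bochner_Integration.integrable_sum) (use * in blast)
  show "(\<integral>y. L y * \<omega> t y \<partial>\<mu>) = 0" unfolding L
    using * by (simp add: Bochner_Integration.integral_sum)
qed

lemma sum_inverse_differences: "(\<Sum>j\<in>J. \<Sum>k\<in>J. 1 / (y j - y k :: real)) = 0"
proof -
  have "(\<Sum>j\<in>J. \<Sum>k\<in>J. 1 / (y j - y k)) = (\<Sum>j\<in>J. \<Sum>k\<in>J. 1 / (y k - y j))"
    by (rule sum.swap)
  also have "\<dots> = - (\<Sum>j\<in>J. \<Sum>k\<in>J. 1 / (y j - y k))"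
    unfolding sum_negf[symmetric] by (intro sum.cong refl) (metis minus_diff_eq minus_divide_right)
  finally show ?thesis by simp
qed

text \<open>
  Symmetrising in \<open>j\<close> and \<open>k\<close> removes the poles at collisions, since the divided difference of
  \<open>u \<mapsto> 1 / (u + \<tau>)\<close> is \<open>- 1 / ((u + \<tau>) (u' + \<tau>))\<close>. The diagonal terms on the left are \<open>0\<close>.
\<close>

lemma sum_divided_differences:
  assumes inj: "inj_on y J" and ne: "\<And>j. j \<in> J \<Longrightarrow> y j + \<tau> \<noteq> 0"
  shows "(\<Sum>j\<in>J. \<Sum>k\<in>J. 1 / (y j + \<tau>) / (y j - y k))
     = ((\<Sum>j\<in>J. (1 / (y j + \<tau>))\<^sup>2) - (inv_gaps \<tau> y)\<^sup>2) / 2"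
proof -
  let ?c = "\<lambda>j. 1 / (y j + \<tau>)"
  have "2 * (\<Sum>j\<in>J. \<Sum>k\<in>J. ?c j / (y j - y k))
      = (\<Sum>j\<in>J. \<Sum>k\<in>J. ?c j / (y j - y k)) + (\<Sum>j\<in>J. \<Sum>k\<in>J. ?c k / (y k - y j))"
    using sum.swap[of "\<lambda>j k. ?c j / (y j - y k)" J J] by simp
  also have "\<dots> = (\<Sum>j\<in>J. \<Sum>k\<in>J. (if j = k then (?c j)\<^sup>2 else 0) - ?c j * ?c k)"
    unfolding sum.distrib[symmetric]
  proof (intro sum.cong refl)
    fix j k assume jk: "j \<in> J" "k \<in> J"
    show "?c j / (y j - y k) + ?c k / (y k - y j) = (if j = k then (?c j)\<^sup>2 else 0) - ?c j * ?c k"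
    proof (cases "j = k")
      case False
      then have "y j - y k \<noteq> 0" "y k - y j \<noteq> 0" using inj jk by (auto simp: inj_on_def)
      moreover have "?c j / (y j - y k) + ?c k / (y k - y j) = (?c j - ?c k) / (y j - y k)"
        using minus_divide_right[of "?c k" "y j - y k"] by (simp add: diff_divide_distrib)
      moreover have "?c j - ?c k = - (?c j * ?c k) * (y j - y k)"
        using ne[OF jk(1)] ne[OF jk(2)] by (simp add: divide_simps)
      ultimately show ?thesis using False by simp
    qed (simp add: power2_eq_square)
  qed
  also have "\<dots> = (\<Sum>j\<in>J. (?c j)\<^sup>2) - (\<Sum>j\<in>J. ?c j) * (\<Sum>k\<in>J. ?c k)"
    using J by (simp add: sum_subtractf sum_product)
  finally show ?thesis by (simp add: inv_gaps_def power2_eq_square)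
qed

abbreviation "N \<equiv> real (card J)"

text \<open>
  The part of the logarithmic derivative of \<open>\<omega>\<close> in \<open>t\<close> that is due to the points other than the
  minimum.
\<close>

definition weight_score :: "real \<Rightarrow> (nat \<Rightarrow> real) \<Rightarrow> real" where
  "weight_score t y = a * inv_gaps t y - \<beta> * N / 2"

lemma weight_score_measurable[measurable]: "weight_score t \<in> borel_measurable \<mu>"
  unfolding weight_score_def[abs_def] by measurable

lemma sum_gap_score: "(\<Sum>j\<in>J. gap_score t j y) = \<beta> * inv_gaps 0 y + weight_score t y"
proof -
  have "(\<Sum>j\<in>J. gap_score t j y) = (\<Sum>j\<in>J. \<beta> / y j) + (\<Sum>j\<in>J. a / (t + y j)) - (\<Sum>j\<in>J. \<beta> / 2)
      + \<beta> * (\<Sum>j\<in>J. \<Sum>k\<in>J. 1 / (y j - y k))"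
    by (simp add: gap_score_def sum.distrib sum_subtractf sum_distrib_left)
  then show ?thesis
    by (simp add: sum_inverse_differences weight_score_def inv_gaps_def sum_distrib_left add.commute[of t])
qed

text \<open>
  The vector field \<open>v\<^sub>j = 1\<close>; the mutual repulsion cancels by antisymmetry.
\<close>

lemma loop_equation_translation:
  assumes t: "t > 0"
  shows "integrable \<mu> (\<lambda>y. (\<beta> * inv_gaps 0 y + weight_score t y) * \<omega> t y)"
    "(\<integral>y. (\<beta> * inv_gaps 0 y + weight_score t y) * \<omega> t y \<partial>\<mu>) = 0"
proof -
  have eq: "(\<Sum>j\<in>J. 0 + 1 * gap_score t j y) = \<beta> * inv_gaps 0 y + weight_score t y" for y
    by (simp add: sum_gap_score)
  note * = summed_loop_equation[where v = "\<lambda>_ _. 1" and v' = "\<lambda>_ _. 0" and B = 1,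
      OF t _ _ _ _ _ _ eq]
  show "integrable \<mu> (\<lambda>y. (\<beta> * inv_gaps 0 y + weight_score t y) * \<omega> t y)"
    by (rule *(1)) auto
  show "(\<integral>y. (\<beta> * inv_gaps 0 y + weight_score t y) * \<omega> t y \<partial>\<mu>) = 0"
    by (rule *(2)) auto
qed

lemma inv_gaps_le:
  assumes "\<forall>k\<in>J. 0 < y k" "\<tau> > 0"
  shows "0 \<le> inv_gaps \<tau> y" "inv_gaps \<tau> y \<le> N / \<tau>"
proof -
  have *: "0 \<le> 1 / (y j + \<tau>)" "1 / (y j + \<tau>) \<le> 1 / \<tau>" if "j \<in> J" for j
  proof -
    have "0 < y j" using assms that by blast
    then show "0 \<le> 1 / (y j + \<tau>)" "1 / (y j + \<tau>) \<le> 1 / \<tau>"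
      using assms(2) by (auto intro!: divide_left_mono)
  qed
  show "0 \<le> inv_gaps \<tau> y" unfolding inv_gaps_def using *(1) by (rule sum_nonneg)
  have "inv_gaps \<tau> y \<le> (\<Sum>j\<in>J. 1 / \<tau>)" unfolding inv_gaps_def using *(2) by (rule sum_mono)
  then show "inv_gaps \<tau> y \<le> N / \<tau>" by simp
qed

lemma inverse_shift_derivative:
  fixes z \<tau> :: real assumes "z + \<tau> > 0"
  shows "((\<lambda>z. 1 / (z + \<tau>)) has_real_derivative - ((1 / (z + \<tau>))\<^sup>2)) (at z)"
proof -
  have "((\<lambda>z. inverse (z + \<tau>)) has_real_derivative - (1 * inverse ((z + \<tau>) ^ Suc (Suc 0)))) (at z)"
    by (rule DERIV_inverse_fun) (use assms in \<open>auto intro!: derivative_eq_intros\<close>)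
  then show ?thesis by (simp add: power2_eq_square inverse_eq_divide)
qed

lemma inv_gaps_upd:
  assumes "j \<in> J"
  shows "inv_gaps \<tau> (y(j := z)) = 1 / (z + \<tau>) + (\<Sum>k\<in>J-{j}. 1 / (y k + \<tau>))"
  unfolding inv_gaps_def by (subst sum.remove[OF J assms]) (auto intro!: sum.cong)

lemma square_inverse_shift_le:
  fixes x \<tau> :: real assumes "x > 0" "\<tau> > 0"
  shows "1 / (x + \<tau>) \<le> 1 / \<tau>" "(1 / (x + \<tau>))\<^sup>2 \<le> (1 / \<tau>)\<^sup>2"
proof -
  show *: "1 / (x + \<tau>) \<le> 1 / \<tau>" using assms by (intro divide_left_mono) auto
  show "(1 / (x + \<tau>))\<^sup>2 \<le> (1 / \<tau>)\<^sup>2" using * assms by (intro power_mono) auto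
qed

text \<open>
  The vector field \<open>v\<^sub>j = \<Sum>\<^sub>k 1 / (y\<^sub>k + \<tau>)\<close>, the same in every coordinate.
\<close>

lemma loop_equation_weighted_translation:
  assumes t: "t > 0" and \<tau>: "\<tau> > 0"
  defines "L \<equiv> \<lambda>y. inv_gaps \<tau> y * (\<beta> * inv_gaps 0 y + weight_score t y) - (\<Sum>j\<in>J. (1 / (y j + \<tau>))\<^sup>2)"
  shows "integrable \<mu> (\<lambda>y. L y * \<omega> t y)" "(\<integral>y. L y * \<omega> t y \<partial>\<mu>) = 0"
proof -
  let ?v = "\<lambda>j::nat. inv_gaps \<tau>" and ?v' = "\<lambda>j y. - ((1 / (y j + \<tau>))\<^sup>2)"
  have bnd: "\<bar>?v j y\<bar> \<le> N / \<tau> + (1 / \<tau>)\<^sup>2" "\<bar>?v' j y\<bar> \<le> N / \<tau> + (1 / \<tau>)\<^sup>2"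
    if "j \<in> J" "\<forall>k\<in>J. 0 < y k" for j and y :: "nat \<Rightarrow> real"
    using inv_gaps_le[OF that(2) \<tau>] square_inverse_shift_le(2)[of "y j" \<tau>] that \<tau>
      zero_le_power2[of "1 / \<tau>"] zero_le_power2[of "1 / (y j + \<tau>)"]
    unfolding abs_minus_cancel abs_power2 by (metis abs_of_nonneg add.commute add_increasing order.trans, metis add_increasing order.trans)
  have der: "((\<lambda>z. ?v j (y(j := z))) has_real_derivative ?v' j (y(j := z))) (at z)"
    if "j \<in> J" "0 < z" for j z and y :: "nat \<Rightarrow> real"
  proof -
    have "((\<lambda>z. 1 / (z + \<tau>) + (\<Sum>k\<in>J-{j}. 1 / (y k + \<tau>))) has_real_derivative
        - ((1 / (z + \<tau>))\<^sup>2) + 0) (at z)"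
      using that \<tau> by (intro DERIV_add inverse_shift_derivative DERIV_const) auto
    then show ?thesis unfolding inv_gaps_upd[OF that(1)] by simp
  qed
  have cont: "continuous_on {0..} (\<lambda>z. ?v j (y(j := z)))" if "j \<in> J" for j and y :: "nat \<Rightarrow> real"
    unfolding inv_gaps_upd[OF that(1)] using \<tau> by (intro continuous_intros) auto
  have eq: "(\<Sum>j\<in>J. ?v' j y + ?v j y * gap_score t j y) = L y" for y
    unfolding sum.distrib sum_distrib_left[symmetric] sum_gap_score L_def sum_negf by simp
  have meas: "?v j \<in> borel_measurable \<mu>" "?v' j \<in> borel_measurable \<mu>" if "j \<in> J" for j
    using that by measurable
  show "integrable \<mu> (\<lambda>y. L y * \<omega> t y)"
    by (rule summed_loop_equation(1)[where v = ?v and v' = ?v' and L = L and t = t and B = "N / \<tau> + (1 / \<tau>)\<^sup>2"])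
       (rule t meas bnd der cont eq; assumption)+
  show "(\<integral>y. L y * \<omega> t y \<partial>\<mu>) = 0"
    by (rule summed_loop_equation(2)[where v = ?v and v' = ?v' and L = L and t = t and B = "N / \<tau> + (1 / \<tau>)\<^sup>2"])
       (rule t meas bnd der cont eq; assumption)+
qed

text \<open>
  The vector field \<open>v\<^sub>j = 1 / (y\<^sub>j + \<tau>)\<close>, which brings in the square of \<open>inv_gaps \<tau>\<close> through the
  mutual repulsion.
\<close>

lemma loop_equation_inversion:
  assumes t: "t > 0" and \<tau>: "\<tau> > 0"
  defines "L \<equiv> \<lambda>y. \<beta> * (\<Sum>j\<in>J. 1 / (y j + \<tau>) / y j) + a * (\<Sum>j\<in>J. 1 / (y j + \<tau>) / (y j + t))
      - \<beta> / 2 * inv_gaps \<tau> y - (\<Sum>j\<in>J. (1 / (y j + \<tau>))\<^sup>2)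
      + \<beta> / 2 * ((\<Sum>j\<in>J. (1 / (y j + \<tau>))\<^sup>2) - (inv_gaps \<tau> y)\<^sup>2)"
  shows "integrable \<mu> (\<lambda>y. L y * \<omega> t y)" "(\<integral>y. L y * \<omega> t y \<partial>\<mu>) = 0"
proof -
  let ?v = "\<lambda>j y. 1 / (y j + \<tau>)" and ?v' = "\<lambda>j y. - ((1 / (y j + \<tau>))\<^sup>2)"
  have bnd: "\<bar>?v j y\<bar> \<le> 1 / \<tau> + (1 / \<tau>)\<^sup>2" "\<bar>?v' j y\<bar> \<le> 1 / \<tau> + (1 / \<tau>)\<^sup>2"
    if "j \<in> J" "\<forall>k\<in>J. 0 < y k" for j and y :: "nat \<Rightarrow> real"
  proof -
    have yj: "0 < y j" using that by auto
    note b = square_inverse_shift_le[OF yj \<tau>]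
    have "0 < 1 / (y j + \<tau>)" "0 < 1 / \<tau>" using yj \<tau> by auto
    then show "\<bar>?v j y\<bar> \<le> 1 / \<tau> + (1 / \<tau>)\<^sup>2" "\<bar>?v' j y\<bar> \<le> 1 / \<tau> + (1 / \<tau>)\<^sup>2"
      using b zero_le_power2[of "1 / \<tau>"] zero_le_power2[of "1 / (y j + \<tau>)"]
      unfolding abs_minus_cancel abs_power2 by linarith+
  qed
  have der: "((\<lambda>z. ?v j (y(j := z))) has_real_derivative ?v' j (y(j := z))) (at z)"
    if "0 < z" for j z and y :: "nat \<Rightarrow> real"
    using inverse_shift_derivative[of z \<tau>] that \<tau> by auto
  have cont: "continuous_on {0..} (\<lambda>z. ?v j (y(j := z)))" for j and y :: "nat \<Rightarrow> real"
    using \<tau> by (auto intro!: continuous_intros)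
  have eq: "(\<Sum>j\<in>J. ?v' j y + ?v j y * gap_score t j y) = L y"
    if pos: "\<forall>k\<in>J. 0 < y k" and inj: "inj_on y J" for y
  proof -
    have "(\<Sum>j\<in>J. ?v' j y + ?v j y * gap_score t j y)
        = (\<Sum>j\<in>J. - ((1 / (y j + \<tau>))\<^sup>2) + \<beta> * (1 / (y j + \<tau>) / y j) + a * (1 / (y j + \<tau>) / (y j + t))
            - \<beta> / 2 * (1 / (y j + \<tau>)) + \<beta> * (\<Sum>k\<in>J. 1 / (y j + \<tau>) / (y j - y k)))"
    proof (intro sum.cong refl)
      fix j
      have "1 / (y j + \<tau>) * (\<Sum>k\<in>J. 1 / (y j - y k)) = (\<Sum>k\<in>J. 1 / (y j + \<tau>) / (y j - y k))"
        by (simp add: sum_distrib_left)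
      then show "?v' j y + ?v j y * gap_score t j y = - ((1 / (y j + \<tau>))\<^sup>2) + \<beta> * (1 / (y j + \<tau>) / y j) + a * (1 / (y j + \<tau>) / (y j + t))
            - \<beta> / 2 * (1 / (y j + \<tau>)) + \<beta> * (\<Sum>k\<in>J. 1 / (y j + \<tau>) / (y j - y k))"
        unfolding gap_score_def by (simp add: algebra_simps del: power_divide)
    qed
    also have "\<dots> = - (\<Sum>j\<in>J. (1 / (y j + \<tau>))\<^sup>2) + \<beta> * (\<Sum>j\<in>J. 1 / (y j + \<tau>) / y j)
        + a * (\<Sum>j\<in>J. 1 / (y j + \<tau>) / (y j + t)) - \<beta> / 2 * inv_gaps \<tau> y
        + \<beta> * (\<Sum>j\<in>J. \<Sum>k\<in>J. 1 / (y j + \<tau>) / (y j - y k))"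
      unfolding inv_gaps_def sum_distrib_left sum_negf[symmetric] sum.distrib[symmetric] sum_subtractf[symmetric] ..
    also have "(\<Sum>j\<in>J. \<Sum>k\<in>J. 1 / (y j + \<tau>) / (y j - y k))
        = ((\<Sum>j\<in>J. (1 / (y j + \<tau>))\<^sup>2) - (inv_gaps \<tau> y)\<^sup>2) / 2"
      using pos \<tau> by (intro sum_divided_differences inj) (metis add_pos_pos less_irrefl)
    finally show ?thesis by (simp add: L_def del: power_divide)
  qed
  have meas: "?v j \<in> borel_measurable \<mu>" "?v' j \<in> borel_measurable \<mu>" if "j \<in> J" for j
    using that by measurable
  show "integrable \<mu> (\<lambda>y. L y * \<omega> t y)"
    by (rule summed_loop_equation(1)[where v = ?v and v' = ?v' and L = L and t = t and B = "1 / \<tau> + (1 / \<tau>)\<^sup>2"])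
       (rule t meas bnd der cont eq; assumption)+
  show "(\<integral>y. L y * \<omega> t y \<partial>\<mu>) = 0"
    by (rule summed_loop_equation(2)[where v = ?v and v' = ?v' and L = L and t = t and B = "1 / \<tau> + (1 / \<tau>)\<^sup>2"])
       (rule t meas bnd der cont eq; assumption)+
qed

lemma moment_bounds:
  assumes T: "T > 0"
  obtains B where "B \<ge> 0" "\<And>t y. 0 < t \<Longrightarrow> t \<le> T \<Longrightarrow> \<bar>\<omega> t y\<bar> \<le> B * envelope y"
    "\<And>t y. 0 < t \<Longrightarrow> t \<le> T \<Longrightarrow> \<bar>inv_gaps 0 y * \<omega> t y\<bar> \<le> B * envelope y"
proof -
  obtain B where B: "B \<ge> 0" "\<And>t y. 0 < t \<Longrightarrow> t \<le> T \<Longrightarrow> \<bar>\<omega> t y\<bar> \<le> B * envelope y"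
    "\<And>t y i. 0 < t \<Longrightarrow> t \<le> T \<Longrightarrow> i \<in> J \<Longrightarrow> \<bar>\<omega> t y / y i\<bar> \<le> B * envelope y"
    using \<omega>_bounds[OF T] by metis
  show ?thesis
  proof (rule that[of "(1 + N) * B"])
    show "(1 + N) * B \<ge> 0" using B(1) by simp
    fix t y assume t: "0 < t" "t \<le> T"
    have NB: "N * (B * envelope y) \<ge> 0" "B * envelope y \<ge> 0" using B(1) envelope_nonneg[of y] by auto
    show "\<bar>\<omega> t y\<bar> \<le> (1 + N) * B * envelope y" 
      using B(2)[OF t, of y] NB unfolding distrib_right mult_1_left mult.assoc by linarith
    have "\<bar>inv_gaps 0 y * \<omega> t y\<bar> \<le> (\<Sum>j\<in>J. \<bar>\<omega> t y / y j\<bar>)"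
      unfolding inv_gaps_def sum_distrib_right by (rule order.trans[OF sum_abs]) simp
    also have "\<dots> \<le> (\<Sum>j\<in>J. B * envelope y)" by (intro sum_mono B(3) t)
    finally show "\<bar>inv_gaps 0 y * \<omega> t y\<bar> \<le> (1 + N) * B * envelope y" 
      using NB by (simp add: distrib_right mult.assoc)
  qed
qed

lemma integrable_moments:
  assumes t: "t > 0"
  shows "integrable \<mu> (\<omega> t)" "integrable \<mu> (\<lambda>y. inv_gaps 0 y * \<omega> t y)"
proof -
  obtain B where B: "\<And>y. \<bar>\<omega> t y\<bar> \<le> B * envelope y" "\<And>y. \<bar>inv_gaps 0 y * \<omega> t y\<bar> \<le> B * envelope y"
    using moment_bounds[OF t] t by (metis order_refl)
  show "integrable \<mu> (\<omega> t)" "integrable \<mu> (\<lambda>y. inv_gaps 0 y * \<omega> t y)"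
    by (rule integrable_dominated[OF _ B(1)], simp, rule integrable_dominated[OF _ B(2)], measurable)
qed

lemma \<omega>_not_pos: "\<not> (\<forall>j\<in>J. 0 < y j) \<Longrightarrow> \<omega> t y = 0"
  unfolding \<omega>_def by (rule if_not_P)

lemma weight_score_bound:
  assumes "\<forall>k\<in>J. 0 < y k" "t > 0"
  shows "\<bar>weight_score t y\<bar> \<le> a * (N / t) + \<beta> * N / 2"
proof -
  have "a * inv_gaps t y \<le> a * (N / t)" "a * inv_gaps t y \<ge> 0"
    using mult_left_mono[OF inv_gaps_le(2)[OF assms] a] inv_gaps_le(1)[OF assms] a by auto
  moreover have "\<beta> * N / 2 \<ge> 0" using \<beta> by simp
  ultimately show ?thesis unfolding weight_score_def by linarith
qed

lemma integrable_bounded_times_inv_gaps: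
  assumes t: "t > 0" and h[measurable]: "h \<in> borel_measurable \<mu>"
    and b: "\<And>y. \<forall>k\<in>J. 0 < y k \<Longrightarrow> \<bar>h y\<bar> \<le> c * inv_gaps 0 y"
  shows "integrable \<mu> (\<lambda>y. h y * \<omega> t y)"
proof (rule Bochner_Integration.integrable_bound[OF integrable_mult_right[OF integrable_moments(2)[OF t], of c]])
  show "AE y in \<mu>. norm (h y * \<omega> t y) \<le> norm (c * (inv_gaps 0 y * \<omega> t y))"
  proof (rule AE_I2)
    fix y
    show "norm (h y * \<omega> t y) \<le> norm (c * (inv_gaps 0 y * \<omega> t y))"
    proof (cases "\<forall>k\<in>J. 0 < y k")
      case True
      have "\<bar>h y\<bar> * \<omega> t y \<le> (c * inv_gaps 0 y) * \<omega> t y"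
        using b[OF True] \<omega>_nonneg by (intro mult_right_mono)
      then show ?thesis using \<omega>_nonneg[of t y] unfolding real_norm_def abs_mult[of "h y"] mult.assoc by simp
    qed (simp add: \<omega>_not_pos)
  qed
qed measurable

text \<open>
  In \<open>- \<beta>\<close> times the second loop equation minus \<open>2\<beta>\<close> times the third one, the squares of
  \<open>inv_gaps\<close> cancel up to a nonnegative remainder; what is left of the sums \<open>Q\<close> of inverse squares is
  \<open>3\<beta>(\<beta> - 1) Q \<ge> 0\<close>. The third claim is uniform in \<open>\<tau>\<close> and serves to pass to \<open>\<tau> = 0\<close>.
\<close>

lemma shifted_gap_inequality:
  assumes t: "t > 0" and \<tau>: "\<tau> \<ge> 0"
  defines "X \<equiv> \<lambda>\<tau> y. \<beta>\<^sup>2 * inv_gaps \<tau> y - \<beta> * inv_gaps \<tau> y * weight_score t y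
      - 2 * \<beta> * a * (\<Sum>j\<in>J. 1 / (y j + \<tau>) / (y j + t))"
  shows "integrable \<mu> (\<lambda>y. X \<tau> y * \<omega> t y)"
    and "\<tau> > 0 \<Longrightarrow> (\<integral>y. X \<tau> y * \<omega> t y \<partial>\<mu>) \<ge> 0"
    and "\<forall>k\<in>J. 0 < y k \<Longrightarrow> \<bar>X \<tau> y\<bar> \<le> (\<beta>\<^sup>2 + \<beta> * (a * (N / t) + \<beta> * N / 2) + 2 * \<beta> * a / t) * inv_gaps 0 y"
proof -
  show bnd: "\<bar>X \<tau> y\<bar> \<le> (\<beta>\<^sup>2 + \<beta> * (a * (N / t) + \<beta> * N / 2) + 2 * \<beta> * a / t) * inv_gaps 0 y"
    if pos: "\<forall>k\<in>J. 0 < y k" for y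
  proof -
    have S: "0 \<le> inv_gaps \<tau> y" "inv_gaps \<tau> y \<le> inv_gaps 0 y"
    proof -
      show "0 \<le> inv_gaps \<tau> y" unfolding inv_gaps_def using pos \<tau>
        by (intro sum_nonneg divide_nonneg_nonneg) (auto intro: add_nonneg_nonneg less_imp_le)
      show "inv_gaps \<tau> y \<le> inv_gaps 0 y" unfolding inv_gaps_def using pos \<tau>
        by (intro sum_mono divide_left_mono) auto
    qed
    have V: "0 \<le> (\<Sum>j\<in>J. 1 / (y j + \<tau>) / (y j + t))" "(\<Sum>j\<in>J. 1 / (y j + \<tau>) / (y j + t)) \<le> inv_gaps 0 y / t"
    proof -
      show "0 \<le> (\<Sum>j\<in>J. 1 / (y j + \<tau>) / (y j + t))" using pos \<tau> t
        by (intro sum_nonneg divide_nonneg_nonneg) (auto intro: add_nonneg_nonneg less_imp_le)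
      show "(\<Sum>j\<in>J. 1 / (y j + \<tau>) / (y j + t)) \<le> inv_gaps 0 y / t"
        unfolding inv_gaps_def sum_divide_distrib using pos \<tau> t
        by (intro sum_mono frac_le divide_left_mono) auto
    qed
    have "\<bar>inv_gaps \<tau> y * weight_score t y\<bar> \<le> inv_gaps 0 y * (a * (N / t) + \<beta> * N / 2)"
      unfolding abs_mult using S weight_score_bound[OF pos t] by (intro mult_mono) auto
    then have "\<beta> * \<bar>inv_gaps \<tau> y * weight_score t y\<bar> \<le> \<beta> * (inv_gaps 0 y * (a * (N / t) + \<beta> * N / 2))"
      using \<beta> by (intro mult_left_mono) auto
    moreover have "2 * \<beta> * a * (\<Sum>j\<in>J. 1 / (y j + \<tau>) / (y j + t)) \<le> 2 * \<beta> * a * (inv_gaps 0 y / t)"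
      using V \<beta> a by (intro mult_left_mono) auto
    moreover have "\<beta>\<^sup>2 * inv_gaps \<tau> y \<le> \<beta>\<^sup>2 * inv_gaps 0 y" using S by (intro mult_left_mono) auto
    moreover have "0 \<le> \<beta>\<^sup>2 * inv_gaps \<tau> y" using S by simp
    moreover have "0 \<le> 2 * \<beta> * a * (\<Sum>j\<in>J. 1 / (y j + \<tau>) / (y j + t))" using V \<beta> a by simp
    moreover have "\<bar>\<beta> * inv_gaps \<tau> y * weight_score t y\<bar> = \<beta> * \<bar>inv_gaps \<tau> y * weight_score t y\<bar>"
      using \<beta> by (simp add: abs_mult)
    moreover have "(\<beta>\<^sup>2 + \<beta> * (a * (N / t) + \<beta> * N / 2) + 2 * \<beta> * a / t) * inv_gaps 0 y
        = \<beta>\<^sup>2 * inv_gaps 0 y + \<beta> * (inv_gaps 0 y * (a * (N / t) + \<beta> * N / 2)) + 2 * \<beta> * a * (inv_gaps 0 y / t)"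
      by (simp add: algebra_simps)
    ultimately show ?thesis unfolding X_def by linarith
  qed
  have [measurable]: "X \<tau> \<in> borel_measurable \<mu>" unfolding X_def by measurable
  show int: "integrable \<mu> (\<lambda>y. X \<tau> y * \<omega> t y)"
    by (rule integrable_bounded_times_inv_gaps[OF t _ bnd]) auto
  show "(\<integral>y. X \<tau> y * \<omega> t y \<partial>\<mu>) \<ge> 0" if \<tau>: "\<tau> > 0"
  proof -
    note A = loop_equation_weighted_translation[OF t \<tau>] and C = loop_equation_inversion[OF t \<tau>]
    let ?A = "\<lambda>y. inv_gaps \<tau> y * (\<beta> * inv_gaps 0 y + weight_score t y) - (\<Sum>j\<in>J. (1 / (y j + \<tau>))\<^sup>2)"
    let ?C = "\<lambda>y. \<beta> * (\<Sum>j\<in>J. 1 / (y j + \<tau>) / y j) + a * (\<Sum>j\<in>J. 1 / (y j + \<tau>) / (y j + t))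
      - \<beta> / 2 * inv_gaps \<tau> y - (\<Sum>j\<in>J. (1 / (y j + \<tau>))\<^sup>2)
      + \<beta> / 2 * ((\<Sum>j\<in>J. (1 / (y j + \<tau>))\<^sup>2) - (inv_gaps \<tau> y)\<^sup>2)"
    have "0 = (\<integral>y. - \<beta> * (?A y * \<omega> t y) - 2 * \<beta> * (?C y * \<omega> t y) \<partial>\<mu>)"
      using A C by simp
    also have "\<dots> \<le> (\<integral>y. X \<tau> y * \<omega> t y \<partial>\<mu>)"
    proof (rule integral_mono)
      show "integrable \<mu> (\<lambda>y. - \<beta> * (?A y * \<omega> t y) - 2 * \<beta> * (?C y * \<omega> t y))"
        using A(1) C(1) by (intro Bochner_Integration.integrable_diff integrable_mult_right)
      show "integrable \<mu> (\<lambda>y. X \<tau> y * \<omega> t y)" by (rule int)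
      fix y
      show "- \<beta> * (?A y * \<omega> t y) - 2 * \<beta> * (?C y * \<omega> t y) \<le> X \<tau> y * \<omega> t y"
      proof (cases "\<forall>k\<in>J. 0 < y k")
        case pos: True
        define Q where "Q = (\<Sum>j\<in>J. (1 / (y j + \<tau>))\<^sup>2)"
        define U where "U = (\<Sum>j\<in>J. 1 / (y j + \<tau>) / y j)"
        define V where "V = (\<Sum>j\<in>J. 1 / (y j + \<tau>) / (y j + t))"
        have Q0: "Q \<ge> 0" unfolding Q_def by (intro sum_nonneg) auto
        have QU: "Q \<le> U" unfolding Q_def U_def
        proof (rule sum_mono)
          fix j assume "j \<in> J"
          then have "0 < y j" using pos by auto
          then show "(1 / (y j + \<tau>))\<^sup>2 \<le> 1 / (y j + \<tau>) / y j"
            using \<tau> by (simp add: power2_eq_square divide_left_mono)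
        qed
        have S: "0 \<le> inv_gaps \<tau> y" "inv_gaps \<tau> y \<le> inv_gaps 0 y"
        proof -
          show "0 \<le> inv_gaps \<tau> y" by (rule inv_gaps_le(1)[OF pos \<tau>])
          show "inv_gaps \<tau> y \<le> inv_gaps 0 y" unfolding inv_gaps_def using pos \<tau>
            by (intro sum_mono divide_left_mono) auto
        qed
        \<comment> \<open>The three summands are the terms that the inequality gives away.\<close>
        have "X \<tau> y - (- \<beta> * ?A y - 2 * \<beta> * ?C y)
          = 2 * \<beta>\<^sup>2 * (U - Q) + 3 * \<beta> * (\<beta> - 1) * Q + \<beta>\<^sup>2 * (inv_gaps \<tau> y * (inv_gaps 0 y - inv_gaps \<tau> y))"
          unfolding X_def Q_def[symmetric] U_def[symmetric] V_def[symmetric]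
          by (simp add: algebra_simps power2_eq_square)
        also have "\<dots> \<ge> 0" using Q0 QU S \<beta> by (intro add_nonneg_nonneg mult_nonneg_nonneg) auto
        finally have "- \<beta> * ?A y - 2 * \<beta> * ?C y \<le> X \<tau> y" by simp
        from mult_right_mono[OF this \<omega>_nonneg[of t y]] show ?thesis
          by (simp only: left_diff_distrib mult.assoc)
      qed (simp add: \<omega>_not_pos)
    qed
    finally show ?thesis .
  qed
qed

section \<open>The differential inequality for the density of the minimum\<close>

text \<open>
  The limit \<open>\<tau> \<rightarrow> 0\<close> of the previous inequality, after the partial fraction decomposition of
  \<open>1 / (y\<^sub>j (y\<^sub>j + t))\<close>.
\<close>

lemma gap_inequality:
  assumes t: "t > 0"
  shows "integrable \<mu> (\<lambda>y. inv_gaps 0 y * weight_score t y * \<omega> t y)"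
    and "\<beta> * (\<integral>y. inv_gaps 0 y * weight_score t y * \<omega> t y \<partial>\<mu>)
      \<le> (\<beta>\<^sup>2 - 2 * \<beta> * a / t) * (\<integral>y. inv_gaps 0 y * \<omega> t y \<partial>\<mu>)
        + 2 * \<beta> * a / t * (\<integral>y. inv_gaps t y * \<omega> t y \<partial>\<mu>)"
proof -
  define X where "X \<tau> y = \<beta>\<^sup>2 * inv_gaps \<tau> y - \<beta> * inv_gaps \<tau> y * weight_score t y
      - 2 * \<beta> * a * (\<Sum>j\<in>J. 1 / (y j + \<tau>) / (y j + t))" for \<tau> y
  define c where "c = \<beta>\<^sup>2 + \<beta> * (a * (N / t) + \<beta> * N / 2) + 2 * \<beta> * a / t"
  note X = shifted_gap_inequality[OF t, folded X_def c_def]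
  have Xm[measurable]: "X \<tau> \<in> borel_measurable \<mu>" for \<tau> unfolding X_def by measurable
  have S0: "0 \<le> inv_gaps 0 y" if "\<forall>k\<in>J. 0 < y k" for y
    unfolding inv_gaps_def using that by (intro sum_nonneg) (auto intro: less_imp_le)
  show int: "integrable \<mu> (\<lambda>y. inv_gaps 0 y * weight_score t y * \<omega> t y)"
  proof (rule integrable_bounded_times_inv_gaps[OF t, where c = "a * (N / t) + \<beta> * N / 2"])
    fix y :: "nat \<Rightarrow> real" assume pos: "\<forall>k\<in>J. 0 < y k"
    show "\<bar>inv_gaps 0 y * weight_score t y\<bar> \<le> (a * (N / t) + \<beta> * N / 2) * inv_gaps 0 y"
      using mult_left_mono[OF weight_score_bound[OF pos t] S0[OF pos]] S0[OF pos]
      by (simp add: abs_mult mult.commute)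
  qed measurable
  \<comment> \<open>Dominated convergence along \<open>\<tau> = 1 / (n + 1)\<close>.\<close>
  have "(\<lambda>n. \<integral>y. X (1 / real (Suc n)) y * \<omega> t y \<partial>\<mu>) \<longlonglongrightarrow> (\<integral>y. X 0 y * \<omega> t y \<partial>\<mu>)"
  proof (rule integral_dominated_convergence[where w = "\<lambda>y. c * (inv_gaps 0 y * \<omega> t y)"])
    show "integrable \<mu> (\<lambda>y. c * (inv_gaps 0 y * \<omega> t y))"
      by (intro integrable_mult_right integrable_moments t)
    show "AE y in \<mu>. (\<lambda>n. X (1 / real (Suc n)) y * \<omega> t y) \<longlonglongrightarrow> X 0 y * \<omega> t y"
    proof (rule AE_I2)
      fix y
      show "(\<lambda>n. X (1 / real (Suc n)) y * \<omega> t y) \<longlonglongrightarrow> X 0 y * \<omega> t y"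
      proof (cases "\<forall>k\<in>J. 0 < y k")
        case pos: True
        have ne: "y j + 0 \<noteq> 0" "y j + t \<noteq> 0" if "j \<in> J" for j
          using pos t that by (auto simp: add_pos_pos less_imp_neq[symmetric])
        have lim: "(\<lambda>n. 1 / real (Suc n)) \<longlonglongrightarrow> 0" using LIMSEQ_inverse_real_of_nat by (simp add: inverse_eq_divide)
        show ?thesis unfolding X_def inv_gaps_def
          by (intro tendsto_intros lim) (use ne in auto)
      qed (simp add: \<omega>_not_pos)
    qed
    show "AE y in \<mu>. norm (X (1 / real (Suc n)) y * \<omega> t y) \<le> c * (inv_gaps 0 y * \<omega> t y)" for n
    proof (rule AE_I2)
      fix y
      show "norm (X (1 / real (Suc n)) y * \<omega> t y) \<le> c * (inv_gaps 0 y * \<omega> t y)"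
      proof (cases "\<forall>k\<in>J. 0 < y k")
        case pos: True
        have "\<bar>X (1 / real (Suc n)) y\<bar> \<le> c * inv_gaps 0 y" by (rule X(3)) (use pos in auto)
        from mult_right_mono[OF this \<omega>_nonneg[of t y]] show ?thesis
          using \<omega>_nonneg[of t y] by (simp add: abs_mult mult.assoc)
      qed (simp add: \<omega>_not_pos)
    qed
  qed measurable
  then have X0: "(\<integral>y. X 0 y * \<omega> t y \<partial>\<mu>) \<ge> 0"
    by (rule LIMSEQ_le_const) (intro exI allI impI X(2), auto)
  have intR: "integrable \<mu> (\<lambda>y. inv_gaps t y * \<omega> t y)"
  proof (rule integrable_bounded_times_inv_gaps[OF t, where c = 1])
    fix y :: "nat \<Rightarrow> real" assume pos: "\<forall>k\<in>J. 0 < y k"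
    have "inv_gaps t y \<le> inv_gaps 0 y" unfolding inv_gaps_def using pos t
      by (intro sum_mono divide_left_mono) (auto intro: add_pos_pos)
    then show "\<bar>inv_gaps t y\<bar> \<le> 1 * inv_gaps 0 y" using inv_gaps_le(1)[OF pos t] by simp
  qed measurable
  have eq: "X 0 y * \<omega> t y = (\<beta>\<^sup>2 - 2 * \<beta> * a / t) * (inv_gaps 0 y * \<omega> t y)
      - \<beta> * (inv_gaps 0 y * weight_score t y * \<omega> t y) + 2 * \<beta> * a / t * (inv_gaps t y * \<omega> t y)" for y
  proof (cases "\<forall>k\<in>J. 0 < y k")
    case pos: True
    have "(\<Sum>j\<in>J. 1 / (y j + 0) / (y j + t)) = (\<Sum>j\<in>J. (1 / (y j + 0) - 1 / (y j + t)) / t)"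
    proof (rule sum.cong)
      fix j assume "j \<in> J"
      then have "0 < y j" using pos by auto
      then have "1 / y j - 1 / (y j + t) = t / (y j * (y j + t))"
        using t by (simp add: divide_simps)
      then show "1 / (y j + 0) / (y j + t) = (1 / (y j + 0) - 1 / (y j + t)) / t"
        using t by simp
    qed simp
    also have "\<dots> = (inv_gaps 0 y - inv_gaps t y) / t"
      by (simp add: inv_gaps_def sum_subtractf sum_divide_distrib[symmetric])
    finally have V: "(\<Sum>j\<in>J. 1 / (y j + 0) / (y j + t)) = (inv_gaps 0 y - inv_gaps t y) / t" .
    show ?thesis unfolding X_def V by (simp add: algebra_simps diff_divide_distrib)
  qed (simp add: \<omega>_not_pos)
  show "\<beta> * (\<integral>y. inv_gaps 0 y * weight_score t y * \<omega> t y \<partial>\<mu>)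
      \<le> (\<beta>\<^sup>2 - 2 * \<beta> * a / t) * (\<integral>y. inv_gaps 0 y * \<omega> t y \<partial>\<mu>)
        + 2 * \<beta> * a / t * (\<integral>y. inv_gaps t y * \<omega> t y \<partial>\<mu>)"
    using X0 int intR integrable_moments(2)[OF t] unfolding eq by simp
qed

lemma has_real_derivative_gamma_density:
  fixes s x r :: real assumes "s + x > 0"
  shows "((\<lambda>s. r * (s + x) powr a * exp (- \<beta> * (s + x) / 2)) has_real_derivative
     r * (s + x) powr a * exp (- \<beta> * (s + x) / 2) * (a / (s + x) - \<beta> / 2)) (at s)"
proof -
  have p: "((\<lambda>s. (s + x) powr a) has_real_derivative (s + x) powr a * (a / (s + x))) (at s)"
  proof -
    have "((\<lambda>s. (s + x) powr a) has_real_derivative a * (s + x) powr (a - 1) * 1) (at s)"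
      by (rule DERIV_chain2[where f = "\<lambda>u. u powr a" and g = "\<lambda>s. s + x", OF has_real_derivative_powr[OF assms]])
         (auto intro!: derivative_eq_intros)
    then show ?thesis using assms by (simp add: powr_diff mult.commute)
  qed
  have e: "((\<lambda>s. exp (- \<beta> * (s + x) / 2)) has_real_derivative exp (- \<beta> * (s + x) / 2) * (- \<beta> / 2)) (at s)"
    by (auto intro!: derivative_eq_intros)
  show ?thesis
    by (rule back_subst[where P = "\<lambda>D. (_ has_real_derivative D) (at s)", OF DERIV_mult[OF DERIV_cmult[OF p] e]])
       (simp add: algebra_simps)
qed

lemma \<omega>_derivative:
  assumes s: "s > 0"
  shows "((\<lambda>s. \<omega> s y) has_real_derivative (a / s - \<beta> / 2 + weight_score s y) * \<omega> s y) (at s)"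
proof (cases "\<forall>j\<in>J. 0 < y j")
  case pos: True
  let ?p = "\<lambda>s. \<Prod>j\<in>J. y j powr \<beta> * (s + y j) powr a * exp (- \<beta> * (s + y j) / 2)"
  have "(?p has_real_derivative ?p s * (\<Sum>j\<in>J. a / (s + y j) - \<beta> / 2)) (at s)"
    using pos s by (intro has_real_derivative_prod_log J has_real_derivative_gamma_density) (auto intro: add_pos_pos)
  moreover have "((\<lambda>s. 1 * (s + 0) powr a * exp (- \<beta> * (s + 0) / 2)) has_real_derivative
      1 * (s + 0) powr a * exp (- \<beta> * (s + 0) / 2) * (a / (s + 0) - \<beta> / 2)) (at s)"
    using s by (intro has_real_derivative_gamma_density) auto
  ultimately have "((\<lambda>s. repulsion \<beta> J y * ((1 * (s + 0) powr a * exp (- \<beta> * (s + 0) / 2)) * ?p s))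
      has_real_derivative repulsion \<beta> J y * (1 * (s + 0) powr a * exp (- \<beta> * (s + 0) / 2) * (a / (s + 0) - \<beta> / 2) * ?p s
        + ?p s * (\<Sum>j\<in>J. a / (s + y j) - \<beta> / 2) * (1 * (s + 0) powr a * exp (- \<beta> * (s + 0) / 2)))) (at s)"
    by (intro DERIV_cmult DERIV_mult)
  moreover have "(\<lambda>s. repulsion \<beta> J y * ((1 * (s + 0) powr a * exp (- \<beta> * (s + 0) / 2)) * ?p s)) = (\<lambda>s. \<omega> s y)"
    using pos by (simp add: \<omega>_def fun_eq_iff)
  moreover have "(\<Sum>j\<in>J. a / (s + y j) - \<beta> / 2) = weight_score s y"
    by (simp add: weight_score_def inv_gaps_def sum_subtractf sum_distrib_left add.commute[of s])
  moreover have "\<omega> s y = s powr a * exp (- \<beta> * s / 2) * repulsion \<beta> J y * ?p s"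
    using pos by (simp add: \<omega>_def)
  ultimately show ?thesis by (simp add: algebra_simps)
qed (simp add: \<omega>_not_pos)

text \<open>
  Differentiation in \<open>t\<close> at fixed gaps differentiates only the weights; it multiplies the integrand by a factor that
  is bounded for \<open>t\<close> away from \<open>0\<close>.
\<close>

lemma moment_derivative:
  assumes t: "t > 0" and g[measurable]: "g \<in> borel_measurable \<mu>"
    and bnd: "\<And>s y. 0 < s \<Longrightarrow> s \<le> 2 * t \<Longrightarrow> \<bar>g y * \<omega> s y\<bar> \<le> B * envelope y"
  shows "((\<lambda>s. \<integral>y. g y * \<omega> s y \<partial>\<mu>) has_real_derivative
     (\<integral>y. (a / t - \<beta> / 2 + weight_score t y) * (g y * \<omega> t y) \<partial>\<mu>)) (at t)"
proof (rule has_real_derivative_under_integral[of "t / 2" t "2 * t"])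
  define c where "c = a / (t / 2) + \<beta> / 2 + (a * (N / (t / 2)) + \<beta> * N / 2)"
  show "integrable \<mu> (\<lambda>y. g y * \<omega> s y)" if "t / 2 < s" "s < 2 * t" for s
    by (rule integrable_dominated[OF _ bnd]) (use that t in auto)
  show "((\<lambda>s. g y * \<omega> s y) has_real_derivative (a / s - \<beta> / 2 + weight_score s y) * (g y * \<omega> s y)) (at s)"
    if "t / 2 < s" "s < 2 * t" for s y
    using DERIV_cmult[OF \<omega>_derivative[of s y], of "g y"] that t by (simp add: algebra_simps)
  show "\<bar>(a / s - \<beta> / 2 + weight_score s y) * (g y * \<omega> s y)\<bar> \<le> c * (B * envelope y)"
    if s: "t / 2 < s" "s < 2 * t" for s y
  proof (cases "\<forall>k\<in>J. 0 < y k")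
    case pos: True
    have s0: "s > 0" using s t by simp
    have "x / s \<le> x / (t / 2)" if "x \<ge> 0" for x
      using that s t by (intro frac_le) auto
    then have "a / s \<le> a / (t / 2)" "a * (N / s) \<le> a * (N / (t / 2))" "a / s \<ge> 0"
      using s0 a by (auto intro!: mult_left_mono simp del: divide_divide_eq_right)
    then have "\<bar>a / s - \<beta> / 2 + weight_score s y\<bar> \<le> c"
      using weight_score_bound[OF pos s0] \<beta> unfolding c_def by linarith
    moreover have "\<bar>g y * \<omega> s y\<bar> \<le> B * envelope y" using s s0 by (intro bnd) auto
    ultimately show ?thesis unfolding abs_mult[of "a / s - \<beta> / 2 + weight_score s y"] by (intro mult_mono) auto
  next
    case False
    have "B * envelope y \<ge> 0" using bnd[of t y] t by simp
    moreover have "c \<ge> 0" using a \<beta> t by (simp add: c_def)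
    ultimately show ?thesis using False by (simp add: \<omega>_not_pos)
  qed
  show "integrable \<mu> (\<lambda>y. c * (B * envelope y))" using integrable_envelope by simp
qed (use t in auto)

definition edge_density :: "real \<Rightarrow> real" where
  "edge_density t = (\<integral>y. \<omega> t y \<partial>\<mu>)"

text \<open>
  The proof sets up \<open>f'\<close> and \<open>f''\<close> from the first moment \<open>S\<close> of the inverse gaps. The first loop
  equation gives \<open>f' = P f - \<beta> S\<close> and eliminates \<open>R\<close>, and \<open>gap_inequality\<close> bounds the mixed moment \<open>W\<close> that
  enters \<open>S'\<close>; the hypothesis compares \<open>K\<^sup>2 + 2\<beta>K/t\<close> with the resulting potential, multiplied by \<open>t\<^sup>2\<close>.
\<close>

lemma edge_density_growth:
  assumes K: "K \<ge> 0"
    and q: "\<And>t. 0 < t \<Longrightarrow> t < s \<Longrightarrow> (K * t)\<^sup>2 + 2 * \<beta> * (K * t)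
        \<le> (a - \<beta> * t / 2)\<^sup>2 - a + 2 * \<beta> * (a - \<beta> * t / 2) - \<beta>\<^sup>2 * N * t"
    and t: "0 < t" "0 \<le> d" "t + d < s"
  shows "edge_density t \<le> exp (- (K * d)) * edge_density (t + d)"
proof -
  define P where "P t = a / t - \<beta> / 2" for t
  define S where "S t = (\<integral>y. inv_gaps 0 y * \<omega> t y \<partial>\<mu>)" for t
  define W where "W t = (\<integral>y. inv_gaps 0 y * weight_score t y * \<omega> t y \<partial>\<mu>)" for t
  let ?f = edge_density
  define f' where "f' t = P t * ?f t - \<beta> * S t" for t
  define S' where "S' t = P t * S t + W t" for t
  define f'' where "f'' t = - (a / t\<^sup>2) * ?f t + P t * f' t - \<beta> * S' t" for t
  have weight_score_mean: "integrable \<mu> (\<lambda>y. weight_score t y * \<omega> t y)" "(\<integral>y. weight_score t y * \<omega> t y \<partial>\<mu>) = - \<beta> * S t" if t: "0 < t" for t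
  proof -
    note l = loop_equation_translation[OF t] and m = integrable_moments[OF t]
    have eq: "weight_score t y * \<omega> t y = (\<beta> * inv_gaps 0 y + weight_score t y) * \<omega> t y - \<beta> * (inv_gaps 0 y * \<omega> t y)" for y
      by (simp add: algebra_simps)
    show "integrable \<mu> (\<lambda>y. weight_score t y * \<omega> t y)" unfolding eq
      by (intro Bochner_Integration.integrable_diff integrable_mult_right l m)
    show "(\<integral>y. weight_score t y * \<omega> t y \<partial>\<mu>) = - \<beta> * S t" unfolding eq
      using l m(2) by (simp add: S_def)
  qed
  have f: "(?f has_real_derivative f' t) (at t)" if t: "0 < t" for t
  proof -
    obtain B where B: "\<And>s y. 0 < s \<Longrightarrow> s \<le> 2 * t \<Longrightarrow> \<bar>\<omega> s y\<bar> \<le> B * envelope y"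
      using moment_bounds[OF mult_pos_pos[OF zero_less_numeral t]] by metis
    have "((\<lambda>s. \<integral>y. 1 * \<omega> s y \<partial>\<mu>) has_real_derivative
       (\<integral>y. (a / t - \<beta> / 2 + weight_score t y) * (1 * \<omega> t y) \<partial>\<mu>)) (at t)"
      by (rule moment_derivative[OF t]) (use B in auto)
    moreover have "(\<integral>y. (a / t - \<beta> / 2 + weight_score t y) * (1 * \<omega> t y) \<partial>\<mu>) = f' t"
      using weight_score_mean[OF t] integrable_moments(1)[OF t]
      by (simp add: distrib_right P_def f'_def edge_density_def)
    ultimately show ?thesis by (simp add: edge_density_def[abs_def])
  qed
  have S: "(S has_real_derivative S' t) (at t)" if t: "0 < t" for t
  proof -
    obtain B where B: "\<And>s y. 0 < s \<Longrightarrow> s \<le> 2 * t \<Longrightarrow> \<bar>inv_gaps 0 y * \<omega> s y\<bar> \<le> B * envelope y"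
      using moment_bounds[OF mult_pos_pos[OF zero_less_numeral t]] by metis
    have "((\<lambda>s. \<integral>y. inv_gaps 0 y * \<omega> s y \<partial>\<mu>) has_real_derivative
       (\<integral>y. (a / t - \<beta> / 2 + weight_score t y) * (inv_gaps 0 y * \<omega> t y) \<partial>\<mu>)) (at t)"
      by (rule moment_derivative[OF t]) (use B in auto)
    moreover have "(\<integral>y. (a / t - \<beta> / 2 + weight_score t y) * (inv_gaps 0 y * \<omega> t y) \<partial>\<mu>) = S' t"
    proof -
      have "(a / t - \<beta> / 2 + weight_score t y) * (inv_gaps 0 y * \<omega> t y)
          = P t * (inv_gaps 0 y * \<omega> t y) + inv_gaps 0 y * weight_score t y * \<omega> t y" for y
        by (simp add: P_def algebra_simps)
      then show ?thesis
        using gap_inequality(1)[OF t] integrable_moments(2)[OF t] by (simp add: S'_def S_def W_def)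
    qed
    ultimately show ?thesis by (simp add: S_def[abs_def])
  qed
  have f': "(f' has_real_derivative f'' t) (at t)" if t: "0 < t" for t
  proof -
    have "(P has_real_derivative - (a / t\<^sup>2)) (at t)" unfolding P_def[abs_def] using t
      by (auto intro!: derivative_eq_intros simp: power2_eq_square)
    then have "((\<lambda>t. P t * ?f t - \<beta> * S t) has_real_derivative
        - (a / t\<^sup>2) * ?f t + f' t * P t - \<beta> * S' t) (at t)"
      by (intro DERIV_diff DERIV_mult DERIV_cmult f[OF t] S[OF t])
    then show ?thesis by (simp add: f'_def[abs_def] f''_def mult.commute)
  qed
  have f0: "?f t \<ge> 0" for t unfolding edge_density_def by (intro Bochner_Integration.integral_nonneg \<omega>_nonneg)
  have ode: "f'' t + (2 * \<beta> / t) * f' t \<ge> (K\<^sup>2 + 2 * \<beta> * K / t) * ?f t" if t: "0 < t" "t < s" for t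
  proof -
    define R where "R = (\<integral>y. inv_gaps t y * \<omega> t y \<partial>\<mu>)"
    have R: "a * R = \<beta> * N / 2 * ?f t - \<beta> * S t"
    proof -
      note d = weight_score_mean[OF t(1)] and m = integrable_moments(1)[OF t(1)]
      have "a * R = (\<integral>y. a * (inv_gaps t y * \<omega> t y) \<partial>\<mu>)" by (simp add: R_def)
      also have "\<dots> = (\<integral>y. weight_score t y * \<omega> t y + \<beta> * N / 2 * \<omega> t y \<partial>\<mu>)"
        by (rule Bochner_Integration.integral_cong) (auto simp: weight_score_def algebra_simps)
      also have "\<dots> = - \<beta> * S t + \<beta> * N / 2 * ?f t" using d m by (simp add: edge_density_def)
      finally show ?thesis by simp
    qed
    have "\<beta> * W t \<le> (\<beta>\<^sup>2 - 2 * \<beta> * a / t) * S t + 2 * \<beta> * a / t * R"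
      using gap_inequality(2)[OF t(1)] by (simp add: W_def S_def R_def)
    also have "2 * \<beta> * a / t * R = 2 * \<beta> / t * (a * R)" by simp
    finally have W: "\<beta> * W t \<le> (\<beta>\<^sup>2 - 2 * \<beta> * a / t) * S t + 2 * \<beta> / t * (\<beta> * N / 2 * ?f t - \<beta> * S t)"
      unfolding R .
    have "(K\<^sup>2 + 2 * \<beta> * K / t) * t\<^sup>2 = (K * t)\<^sup>2 + 2 * \<beta> * (K * t)"
      using t by (simp add: field_simps power2_eq_square)
    also have "\<dots> \<le> (a - \<beta> * t / 2)\<^sup>2 - a + 2 * \<beta> * (a - \<beta> * t / 2) - \<beta>\<^sup>2 * N * t"
      by (rule q[OF t])
    also have "\<dots> = ((P t)\<^sup>2 - a / t\<^sup>2 + 2 * \<beta> / t * P t - \<beta>\<^sup>2 * N / t) * t\<^sup>2"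
      using t by (simp add: P_def field_simps power2_eq_square)
    finally have "K\<^sup>2 + 2 * \<beta> * K / t \<le> (P t)\<^sup>2 - a / t\<^sup>2 + 2 * \<beta> / t * P t - \<beta>\<^sup>2 * N / t"
      using t by (simp add: mult_le_cancel_right)
    then have "(K\<^sup>2 + 2 * \<beta> * K / t) * ?f t \<le> ((P t)\<^sup>2 - a / t\<^sup>2 + 2 * \<beta> / t * P t - \<beta>\<^sup>2 * N / t) * ?f t"
      by (rule mult_right_mono[OF _ f0])
    also have "\<dots> = - (a / t\<^sup>2) * ?f t + P t * f' t - \<beta> * (P t * S t) + (2 * \<beta> / t) * f' t
       - ((\<beta>\<^sup>2 - 2 * \<beta> * a / t) * S t + 2 * \<beta> / t * (\<beta> * N / 2 * ?f t - \<beta> * S t))"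
      using t by (simp add: f'_def P_def field_simps power2_eq_square)
    also have "\<dots> \<le> f'' t + (2 * \<beta> / t) * f' t"
      using W by (simp add: f''_def S'_def distrib_left)
    finally show ?thesis .
  qed
  obtain B where B: "\<And>t y. 0 < t \<Longrightarrow> t \<le> 1 \<Longrightarrow> \<bar>\<omega> t y\<bar> \<le> B * envelope y"
      "\<And>t y. 0 < t \<Longrightarrow> t \<le> 1 \<Longrightarrow> \<bar>inv_gaps 0 y * \<omega> t y\<bar> \<le> B * envelope y"
    using moment_bounds[OF zero_less_one] by metis
  \<comment> \<open>Crude bounds near \<open>t = 0\<close> that start the growth argument.\<close>
  define B1 where "B1 = (\<integral>y. B * envelope y \<partial>\<mu>)"
  have mb: "\<bar>?f t\<bar> \<le> B1" "\<bar>S t\<bar> \<le> B1" if t: "0 < t" "t \<le> 1" for t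
  proof -
    show "\<bar>?f t\<bar> \<le> B1" unfolding edge_density_def B1_def
      by (rule order.trans[OF integral_abs_bound], rule integral_mono)
         (use integrable_moments[OF t(1)] integrable_envelope B(1)[OF t] in auto)
    show "\<bar>S t\<bar> \<le> B1" unfolding S_def B1_def
      by (rule order.trans[OF integral_abs_bound], rule integral_mono)
         (use integrable_moments[OF t(1)] integrable_envelope B(2)[OF t] in auto)
  qed
  have B1: "B1 \<ge> 0" using mb(1)[of 1] by simp
  define B2 where "B2 = (a + \<beta> / 2 + \<beta> + 1) * B1"
  have mb': "\<bar>f' t\<bar> \<le> B2 / t" if t: "0 < t" "t \<le> 1" for t
  proof -
    have "\<bar>t * f' t\<bar> = \<bar>(a - \<beta> * t / 2) * ?f t - \<beta> * t * S t\<bar>"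
      using t by (simp add: f'_def P_def algebra_simps)
    also have "\<dots> \<le> (a + \<beta> / 2) * B1 + \<beta> * B1"
    proof (rule order.trans[OF abs_triangle_ineq4], rule add_mono)
      have "\<beta> * t \<le> \<beta> * 1" "0 \<le> \<beta> * t" using t \<beta> by (auto intro: mult_left_mono)
      then have "\<bar>a - \<beta> * t / 2\<bar> \<le> a + \<beta> / 2" "\<bar>\<beta> * t\<bar> \<le> \<beta>" using a by auto
      then show "\<bar>(a - \<beta> * t / 2) * ?f t\<bar> \<le> (a + \<beta> / 2) * B1" "\<bar>\<beta> * t * S t\<bar> \<le> \<beta> * B1"
        unfolding abs_mult[of "a - \<beta> * t / 2"] abs_mult[of "\<beta> * t"]
        using mb[OF t] a \<beta> by (auto intro!: mult_mono)
    qed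
    also have "\<dots> \<le> B2" using B1 by (simp add: B2_def algebra_simps)
    finally show ?thesis using t by (simp add: abs_mult field_simps)
  qed
  have mb'': "\<bar>?f t\<bar> \<le> B2" if t: "0 < t" "t \<le> 1" for t
  proof -
    have "1 * B1 \<le> B2" unfolding B2_def using a \<beta> B1 by (intro mult_right_mono) auto
    then show ?thesis using mb(1)[OF t] by simp
  qed
  show ?thesis
    by (rule exponential_growth_of_ode_inequality[OF \<beta> K f f' ode mb'' mb' t])
qed

lemma edge_density_nonneg: "edge_density t \<ge> 0"
  unfolding edge_density_def by (intro Bochner_Integration.integral_nonneg \<omega>_nonneg)

lemma edge_density_continuous: "continuous_on {0<..} edge_density"
proof (intro continuous_at_imp_continuous_on ballI)
  fix t :: real assume "t \<in> {0<..}"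
  then have t: "t > 0" by simp
  obtain B where B: "\<And>s y. 0 < s \<Longrightarrow> s \<le> 2 * t \<Longrightarrow> \<bar>\<omega> s y\<bar> \<le> B * envelope y"
    using moment_bounds[OF mult_pos_pos[OF zero_less_numeral t]] by metis
  have "isCont (\<lambda>s. \<integral>y. 1 * \<omega> s y \<partial>\<mu>) t"
    by (rule DERIV_isCont, rule moment_derivative[OF t]) (use B in auto)
  then show "isCont edge_density t" by (simp add: edge_density_def[abs_def])
qed

lemma edge_density_measurable:
  "(\<lambda>t. ennreal (edge_density t) * indicator {0<..} t) \<in> borel_measurable borel"
proof -
  have "(\<lambda>t. indicator {0<..} t *\<^sub>R edge_density t) \<in> borel_measurable borel"
    by (intro borel_measurable_continuous_on_indicator edge_density_continuous) auto
  then have "(\<lambda>t. ennreal (indicator {0<..} t *\<^sub>R edge_density t)) \<in> borel_measurable borel"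
    by measurable
  also have "(\<lambda>t. ennreal (indicator {0<..} t *\<^sub>R edge_density t)) = (\<lambda>t. ennreal (edge_density t) * indicator {0<..} t)"
    by (auto simp: indicator_def)
  finally show ?thesis .
qed

lemma nn_integral_edge_density_le:
  assumes K: "K \<ge> 0" and d: "d \<ge> 0" "r + d < s"
    and q: "\<And>t. 0 < t \<Longrightarrow> t < s \<Longrightarrow> (K * t)\<^sup>2 + 2 * \<beta> * (K * t)
        \<le> (a - \<beta> * t / 2)\<^sup>2 - a + 2 * \<beta> * (a - \<beta> * t / 2) - \<beta>\<^sup>2 * N * t"
  shows "(\<integral>\<^sup>+ t. ennreal (edge_density t) * indicator {0<..r} t \<partial>lborel)
     \<le> ennreal (exp (- (K * d))) * (\<integral>\<^sup>+ t. ennreal (edge_density t) * indicator {0<..} t \<partial>lborel)"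
proof -
  define g where "g t = ennreal (edge_density t) * indicator {0<..} t" for t
  have gm[measurable]: "g \<in> borel_measurable borel" unfolding g_def[abs_def] by (rule edge_density_measurable)
  have "(\<integral>\<^sup>+ t. ennreal (edge_density t) * indicator {0<..r} t \<partial>lborel)
     \<le> (\<integral>\<^sup>+ t. ennreal (exp (- (K * d))) * g (d + 1 * t) \<partial>lborel)"
  proof (rule nn_integral_mono)
    fix t :: real
    show "ennreal (edge_density t) * indicator {0<..r} t \<le> ennreal (exp (- (K * d))) * g (d + 1 * t)"
    proof (cases "t \<in> {0<..r}")
      case True
      then have "edge_density t \<le> exp (- (K * d)) * edge_density (t + d)"
        using d by (intro edge_density_growth[OF K q]) auto
      then have "ennreal (edge_density t) \<le> ennreal (exp (- (K * d))) * ennreal (edge_density (t + d))"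
        by (subst ennreal_mult[symmetric]) (auto simp: edge_density_nonneg intro!: ennreal_leI)
      then show ?thesis using True d by (simp add: g_def add.commute)
    qed simp
  qed
  also have "\<dots> = ennreal (exp (- (K * d))) * (\<integral>\<^sup>+ t. g (d + 1 * t) \<partial>lborel)"
    by (rule nn_integral_cmult, rule measurable_compose[OF _ gm]) simp
  also have "(\<integral>\<^sup>+ t. g (d + 1 * t) \<partial>lborel) = (\<integral>\<^sup>+ t. g t \<partial>lborel)"
    using nn_integral_real_affine[OF gm, of 1 d] by simp
  finally show ?thesis by (simp add: g_def)
qed

end

section \<open>The smallest point of the Laguerre ensemble\<close>

lemma laguerre_unnorm_density_eq:
  "laguerre_unnorm_density \<beta> n \<kappa> x = (if \<forall>k<n. 0 < x k
     then repulsion \<beta> {..<n} x * (\<Prod>k<n. laguerre_weight \<beta> n \<kappa> (x k)) else 0)"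
  unfolding laguerre_unnorm_density_def repulsion_lessThan by (rule refl)

lemma laguerre_unnorm_density_measurable:
  assumes "\<beta> \<ge> 1"
  shows "laguerre_unnorm_density \<beta> n \<kappa> \<in> borel_measurable (Pi\<^sub>M {..<n} (\<lambda>_. lborel))"
proof -
  let ?M = "Pi\<^sub>M {..<n} (\<lambda>_. lborel :: real measure)"
  have c[measurable]: "(\<lambda>x. x k) \<in> borel_measurable ?M" if "k \<in> {..<n}" for k
    using measurable_component_singleton[OF that, of "\<lambda>_. lborel :: real measure"] by simp
  have "min_at_edge {..<n} \<beta> 0" by standard (use assms in auto)
  from min_at_edge.repulsion_measurable[OF this]
  have [measurable]: "repulsion \<beta> {..<n} \<in> borel_measurable ?M"
    unfolding min_at_edge.\<mu>_def[OF \<open>min_at_edge {..<n} \<beta> 0\<close>] .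
  have [measurable]: "Measurable.pred ?M (\<lambda>x. \<forall>k\<in>{..<n}. 0 < x k)"
    using c by (intro pred_intros_finite) (auto intro: borel_measurable_const)
  have [measurable]: "laguerre_weight \<beta> n \<kappa> \<in> borel_measurable borel"
    unfolding laguerre_weight_def[abs_def] by measurable
  have [measurable]: "(\<lambda>x. \<Prod>k\<in>{..<n}. laguerre_weight \<beta> n \<kappa> (x k)) \<in> borel_measurable ?M"
    by (intro borel_measurable_prod measurable_compose[OF c]) auto
  have "(\<lambda>x. if \<forall>k\<in>{..<n}. 0 < x k
     then repulsion \<beta> {..<n} x * (\<Prod>k\<in>{..<n}. laguerre_weight \<beta> n \<kappa> (x k)) else 0)
     \<in> borel_measurable ?M"
    by measurable
  then show ?thesis by (simp add: laguerre_unnorm_density_eq[abs_def] Ball_def)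
qed

lemma borel_measurable_restrict_min_at:
  fixes g :: "(nat \<Rightarrow> real) \<Rightarrow> ennreal"
  assumes [measurable]: "g \<in> borel_measurable (Pi\<^sub>M {..<n} (\<lambda>_. lborel))" and i: "i < n" and A: "A \<in> sets borel"
  shows "(\<lambda>x. g x * indicator {x. x i \<in> A \<and> (\<forall>j\<in>{..<n} - {i}. x i < x j)} x)
    \<in> borel_measurable (Pi\<^sub>M {..<n} (\<lambda>_. lborel))"
proof -
  let ?M = "Pi\<^sub>M {..<n} (\<lambda>_. lborel :: real measure)"
  have c: "(\<lambda>x. x k) \<in> borel_measurable ?M" if "k < n" for k
    using measurable_component_singleton[of k "{..<n}" "\<lambda>_. lborel :: real measure"] that by simp
  have [measurable]: "Measurable.pred ?M (\<lambda>x. x i \<in> A)" 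
    using measurable_compose[OF c[OF i] , of "\<lambda>u. u \<in> A" "count_space UNIV"] A by simp
  have [measurable]: "Measurable.pred ?M (\<lambda>x. \<forall>j\<in>{..<n} - {i}. x i < x j)"
    using c i by (intro pred_intros_finite) (auto intro: borel_measurable_less)
  have "(\<lambda>x. if x i \<in> A \<and> (\<forall>j\<in>{..<n} - {i}. x i < x j) then g x else 0) \<in> borel_measurable ?M"
    by measurable
  also have "(\<lambda>x. if x i \<in> A \<and> (\<forall>j\<in>{..<n} - {i}. x i < x j) then g x else 0)
      = (\<lambda>x. g x * indicator {x. x i \<in> A \<and> (\<forall>j\<in>{..<n} - {i}. x i < x j)} x)"
    by (auto simp: fun_eq_iff)
  finally show ?thesis .
qed

text \<open>
  Integrate out the coordinate \<open>i\<close> last and translate the others by its value \<open>t\<close>: the other coordinates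
  become the gaps.
\<close>

lemma laguerre_mass_min_at:
  fixes \<beta> \<kappa> a :: real
  assumes i: "i < n" and \<beta>: "\<beta> \<ge> 1" and a_eq: "a = \<beta> / 2 * (\<kappa> - real n + 1) - 1" and a0: "a \<ge> 0" and A[measurable]: "A \<in> sets borel" "A \<subseteq> {0<..}"
  defines "J \<equiv> {..<n} - {i}"
  shows "(\<integral>\<^sup>+ x. ennreal (laguerre_unnorm_density \<beta> n \<kappa> x) * indicator {x. x i \<in> A \<and> (\<forall>j\<in>J. x i < x j)} x \<partial>(\<Pi>\<^sub>M k\<in>{..<n}. lborel))
     = (\<integral>\<^sup>+ t. ennreal (min_at_edge.edge_density J \<beta> a t) * indicator A t \<partial>lborel)"
proof -
  interpret min_at_edge J \<beta> a by standard (use assms in \<open>auto simp: J_def\<close>)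
  interpret product_sigma_finite "\<lambda>_. lborel :: real measure" ..
  have ins: "insert i J = {..<n}" and iJ: "i \<notin> J" using i by (auto simp: J_def)
  let ?M = "\<Pi>\<^sub>M k\<in>{..<n}. (lborel :: real measure)"
  define h where "h x = ennreal (laguerre_unnorm_density \<beta> n \<kappa> x) * indicator {x. x i \<in> A \<and> (\<forall>j\<in>J. x i < x j)} x" for x
  have hm: "h \<in> borel_measurable ?M"
    unfolding h_def[abs_def] J_def using laguerre_unnorm_density_measurable[OF \<beta>]
    by (intro borel_measurable_restrict_min_at i A) auto
  have "(\<integral>\<^sup>+ x. h x \<partial>?M) = (\<integral>\<^sup>+ t. (\<integral>\<^sup>+ x. h (x(i := t)) \<partial>Pi\<^sub>M J (\<lambda>_. lborel)) \<partial>lborel)"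
    using product_nn_integral_insert_rev[OF J iJ, of h] hm unfolding ins by simp
  also have "\<dots> = (\<integral>\<^sup>+ t. ennreal (edge_density t) * indicator A t \<partial>lborel)"
  proof (rule nn_integral_cong)
    fix t :: real
    have upd: "(\<lambda>x. x(i := t)) \<in> measurable (Pi\<^sub>M J (\<lambda>_. lborel :: real measure)) ?M"
      unfolding ins[symmetric] by (rule measurable_fun_upd[where J = J]) auto
    have "(\<integral>\<^sup>+ x. h (x(i := t)) \<partial>Pi\<^sub>M J (\<lambda>_. lborel))
        = (\<integral>\<^sup>+ y. h ((\<lambda>j\<in>J. y j + t)(i := t)) \<partial>Pi\<^sub>M J (\<lambda>_. lborel))"
      by (rule nn_integral_PiM_lborel_shift[OF J, where f = "\<lambda>x. h (x(i := t))"]) (rule measurable_compose[OF upd hm])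
    also have "\<dots> = (\<integral>\<^sup>+ y. ennreal (\<omega> t y) * indicator A t \<partial>\<mu>)"
      unfolding \<mu>_def
    proof (rule nn_integral_cong)
      fix y :: "nat \<Rightarrow> real"
      define x where "x = (\<lambda>j\<in>J. y j + t)(i := t)"
      have xi: "x i = t" and xj: "x j = y j + t" if "j \<in> J" for j
        using that iJ by (auto simp: x_def)
      have xi: "x i = t" by (simp add: x_def)
      show "h x = ennreal (\<omega> t y) * indicator A t"
      proof (cases "t \<in> A \<and> (\<forall>j\<in>J. 0 < y j)")
        case True
        then have t: "t > 0" and y: "\<forall>j\<in>J. 0 < y j" using A by auto
        have pos: "\<forall>k<n. 0 < x k"
        proof (intro allI impI)
          fix k assume "k < n"
          then have "k = i \<or> k \<in> J" by (auto simp: J_def)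
          then show "0 < x k" using xi xj t y by (auto intro: add_pos_pos)
        qed
        have "repulsion \<beta> {..<n} x = repulsion \<beta> J y * (\<Prod>k\<in>J. y k powr \<beta>)"
        proof -
          have "repulsion \<beta> (insert i J) x = repulsion \<beta> J x * (\<Prod>k\<in>J. \<bar>x i - x k\<bar> powr \<beta>)"
            by (rule repulsion_insert[OF J iJ])
          moreover have "repulsion \<beta> J x = repulsion \<beta> J y" by (rule repulsion_shift[OF xj])
          moreover have "(\<Prod>k\<in>J. \<bar>x i - x k\<bar> powr \<beta>) = (\<Prod>k\<in>J. y k powr \<beta>)"
            using y by (intro prod.cong) (auto simp: xi xj less_imp_le)
          ultimately show ?thesis by (simp add: ins)
        qed
        moreover have "(\<Prod>k<n. laguerre_weight \<beta> n \<kappa> (x k))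
            = t powr a * exp (- \<beta> * t / 2) * (\<Prod>j\<in>J. (t + y j) powr a * exp (- \<beta> * (t + y j) / 2))"
        proof -
          have "(\<Prod>k\<in>insert i J. laguerre_weight \<beta> n \<kappa> (x k))
              = laguerre_weight \<beta> n \<kappa> t * (\<Prod>k\<in>J. laguerre_weight \<beta> n \<kappa> (t + y k))"
            using J iJ by (simp add: xi xj add.commute cong: prod.cong)
          moreover have "laguerre_weight \<beta> n \<kappa> u = u powr a * exp (- \<beta> * u / 2)" for u
            unfolding laguerre_weight_def a_eq by simp
          ultimately show ?thesis unfolding ins by simp
        qed
        ultimately have "laguerre_unnorm_density \<beta> n \<kappa> x = \<omega> t y"
          using pos y by (simp add: laguerre_unnorm_density_eq \<omega>_def prod.distrib mult_ac)
        moreover have "x i \<in> A \<and> (\<forall>j\<in>J. x i < x j)" using True by (auto simp: xi xj)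
        ultimately show ?thesis using True by (simp add: h_def)
      next
        case False
        then show ?thesis
        proof (cases "t \<in> A")
          case True
          then have "\<not> (\<forall>j\<in>J. 0 < y j)" using False by simp
          moreover from this have "\<not> (\<forall>j\<in>J. x i < x j)" by (auto simp: xi xj)
          ultimately show ?thesis by (simp add: h_def \<omega>_not_pos del: ball_simps)
        qed (simp add: h_def xi)
      qed
    qed
    also have "\<dots> = ennreal (edge_density t) * indicator A t"
    proof (cases "t \<in> A")
      case True
      then have "t > 0" using A by auto
      then show ?thesis unfolding edge_density_def using True
        by (simp add: nn_integral_eq_integral integrable_moments \<omega>_nonneg)
    qed simp
    finally show "(\<integral>\<^sup>+ x. h (x(i := t)) \<partial>Pi\<^sub>M J (\<lambda>_. lborel)) = ennreal (edge_density t) * indicator A t" .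
  qed
  finally show ?thesis by (simp add: h_def)
qed

text \<open>
  The configurations without ties split according to the index of their minimum, and the density vanishes
  on ties. So a comparison of masses for each index gives one for the whole ensemble, and dividing by
  the partition function preserves it.
\<close>

lemma laguerre_lambda_min_le:
  fixes \<beta> \<kappa> a \<theta> :: real
  assumes n: "n \<ge> 1" and \<beta>: "\<beta> \<ge> 1" and a: "a = \<beta> / 2 * (\<kappa> - real n + 1) - 1" "a \<ge> 0" and \<theta>: "\<theta> \<ge> 0"
    and le: "\<And>i. i < n \<Longrightarrow>
      (\<integral>\<^sup>+ t. ennreal (min_at_edge.edge_density ({..<n} - {i}) \<beta> a t) * indicator {0<..c} t \<partial>lborel)
      \<le> ennreal \<theta> * (\<integral>\<^sup>+ t. ennreal (min_at_edge.edge_density ({..<n} - {i}) \<beta> a t) * indicator {0<..} t \<partial>lborel)"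
  shows "\<P>(x in laguerre_ensemble \<beta> n \<kappa>. lambda_min n x \<le> c) \<le> \<theta>"
proof -
  let ?M = "\<Pi>\<^sub>M k\<in>{..<n}. (lborel :: real measure)"
  define \<rho> where "\<rho> x = ennreal (laguerre_unnorm_density \<beta> n \<kappa> x)" for x
  define Z where "Z = laguerre_partition \<beta> n \<kappa>"
  have \<rho>m[measurable]: "\<rho> \<in> borel_measurable ?M"
    unfolding \<rho>_def using laguerre_unnorm_density_measurable[OF \<beta>] by measurable
  let ?E = "{x \<in> space ?M. lambda_min n x \<le> c}"
  let ?m = "\<lambda>i A. {x :: nat \<Rightarrow> real. x i \<in> A \<and> (\<forall>j\<in>{..<n} - {i}. x i < x j)}"
  have mm: "(\<lambda>x. \<rho> x * indicator (?m i A) x) \<in> borel_measurable ?M" if "i < n" "A \<in> sets borel" for i A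
    by (rule borel_measurable_restrict_min_at[OF \<rho>m that])
  have "(\<integral>\<^sup>+ x. \<rho> x * indicator ?E x \<partial>?M) \<le> (\<integral>\<^sup>+ x. (\<Sum>i<n. \<rho> x * indicator (?m i {0<..c}) x) \<partial>?M)"
  proof (rule nn_integral_mono)
    fix x
    show "\<rho> x * indicator ?E x \<le> (\<Sum>i<n. \<rho> x * indicator (?m i {0<..c}) x)"
    proof (cases "laguerre_unnorm_density \<beta> n \<kappa> x \<noteq> 0 \<and> x \<in> ?E")
      case True
      then have pos: "\<forall>k<n. 0 < x k" and inj: "inj_on x {..<n}"
        using repulsion_eq_0[of "{..<n}" x \<beta>] by (auto simp: laguerre_unnorm_density_eq split: if_splits)
      have "Min (x ` {..<n}) \<in> x ` {..<n}" using n by (intro Min_in) (auto simp: lessThan_empty_iff)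
      then obtain i where i: "i < n" "x i = Min (x ` {..<n})" by auto
      have "x i < x j" if j: "j \<in> {..<n} - {i}" for j
      proof -
        have "x i \<le> x j" using i j by simp
        moreover have "x i \<noteq> x j" using inj i j by (auto simp: inj_on_def)
        ultimately show ?thesis by simp
      qed
      moreover have "x i \<in> {0<..c}" using True i pos by (auto simp: lambda_min_def)
      ultimately have "\<rho> x * indicator ?E x \<le> \<rho> x * indicator (?m i {0<..c}) x" by (auto split: split_indicator)
      also have "\<dots> \<le> (\<Sum>i<n. \<rho> x * indicator (?m i {0<..c}) x)" using i by (intro member_le_sum) auto
      finally show ?thesis .
    qed (auto simp: \<rho>_def)
  qed
  also have "\<dots> = (\<Sum>i<n. \<integral>\<^sup>+ x. \<rho> x * indicator (?m i {0<..c}) x \<partial>?M)"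
    by (rule nn_integral_sum) (auto intro!: mm)
  also have "\<dots> \<le> (\<Sum>i<n. ennreal \<theta> * (\<integral>\<^sup>+ x. \<rho> x * indicator (?m i {0<..}) x \<partial>?M))"
  proof (rule sum_mono)
    fix i assume "i \<in> {..<n}"
    then have i: "i < n" by simp
    show "(\<integral>\<^sup>+ x. \<rho> x * indicator (?m i {0<..c}) x \<partial>?M) \<le> ennreal \<theta> * (\<integral>\<^sup>+ x. \<rho> x * indicator (?m i {0<..}) x \<partial>?M)"
    proof -
      have "{0<..c} \<subseteq> {0<..}" by auto
      then show ?thesis unfolding \<rho>_def
        using le[OF i] laguerre_mass_min_at[OF i \<beta> a, of "{0<..c}"] laguerre_mass_min_at[OF i \<beta> a, of "{0<..}"]
        by simp
    qed
  qed
  also have "\<dots> = ennreal \<theta> * (\<integral>\<^sup>+ x. (\<Sum>i<n. \<rho> x * indicator (?m i {0<..}) x) \<partial>?M)"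
    by (subst nn_integral_sum) (auto intro!: mm simp: sum_distrib_left)
  also have "\<dots> \<le> ennreal \<theta> * (\<integral>\<^sup>+ x. \<rho> x \<partial>?M)"
  proof (intro mult_left_mono nn_integral_mono)
    fix x
    show "(\<Sum>i<n. \<rho> x * indicator (?m i {0<..}) x) \<le> \<rho> x"
    proof (cases "\<exists>i<n. x \<in> ?m i {0<..}")
      case True
      then obtain i where i: "i < n" "x \<in> ?m i {0<..}" by blast
      have "(\<Sum>k<n. \<rho> x * indicator (?m k {0<..}) x) = (\<Sum>k<n. if k = i then \<rho> x else 0)"
      proof (rule sum.cong)
        fix k assume k: "k \<in> {..<n}"
        have "x \<notin> ?m k {0<..}" if "k \<noteq> i"
        proof
          assume "x \<in> ?m k {0<..}"
          then have "x k < x i" using i that by auto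
          moreover have "x i < x k" using i k that by auto
          ultimately show False by simp
        qed
        then show "\<rho> x * indicator (?m k {0<..}) x = (if k = i then \<rho> x else 0)" using i by auto
      qed simp
      then show ?thesis using i by simp
    next
      case False
      then have "(\<Sum>k<n. \<rho> x * indicator (?m k {0<..}) x) = 0" by (intro sum.neutral) auto
      then show ?thesis by (simp only: zero_le)
    qed
  qed simp
  finally have main: "(\<integral>\<^sup>+ x. \<rho> x * indicator ?E x \<partial>?M) \<le> ennreal \<theta> * Z"
    by (simp add: Z_def laguerre_partition_def \<rho>_def)
  have L: "laguerre_ensemble \<beta> n \<kappa> = density ?M (\<lambda>x. \<rho> x / Z)"
    by (simp add: laguerre_ensemble_def \<rho>_def Z_def)
  have E: "{x \<in> space (laguerre_ensemble \<beta> n \<kappa>). lambda_min n x \<le> c} = ?E" by (simp add: L)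
  show ?thesis
  proof (cases "?E \<in> sets ?M")
    case True
    have "emeasure (laguerre_ensemble \<beta> n \<kappa>) ?E = (\<integral>\<^sup>+ x. \<rho> x / Z * indicator ?E x \<partial>?M)"
      unfolding L using True by (intro emeasure_density) auto
    also have "\<dots> = (\<integral>\<^sup>+ x. (\<rho> x * indicator ?E x) / Z \<partial>?M)"
      by (intro nn_integral_cong) (auto split: split_indicator)
    also have "\<dots> = (\<integral>\<^sup>+ x. \<rho> x * indicator ?E x \<partial>?M) / Z"
      using True by (intro nn_integral_divide borel_measurable_times_ennreal \<rho>m borel_measurable_indicator)
    also have "\<dots> \<le> ennreal \<theta> * Z / Z" by (intro divide_right_mono_ennreal main)
    also have "\<dots> \<le> ennreal \<theta>"
    proof -
      have "Z / Z \<le> 1" by (cases "Z = 0 \<or> Z = \<top>") (auto simp: ennreal_divide_self less_top)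
      then have "ennreal \<theta> * (Z / Z) \<le> ennreal \<theta> * 1" by (intro mult_left_mono) auto
      then show ?thesis by (simp add: ennreal_times_divide)
    qed
    finally show ?thesis unfolding E measure_def using \<theta> by (intro enn2real_leI) auto
  next
    case False
    then have "measure (laguerre_ensemble \<beta> n \<kappa>) ?E = 0"
      by (intro measure_notin_sets) (simp add: L)
    then show ?thesis unfolding E using \<theta> by simp
  qed
qed


section \<open>The tail bound at the edge\<close>

text \<open>
  Put \<open>g = \<surd>(\<kappa>n)\<close>, \<open>m = \<kappa> - n\<close> and \<open>\<delta> = s - t\<close>. The leading part of the difference is the quadratic
  \<open>\<delta>\<^sup>2 + 4g\<delta>\<close>, because \<open>m\<^sup>2 = s (s + 4g)\<close>; half of \<open>4g\<delta>\<close> is kept for the claim. The lower order terms are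
  nonnegative because \<open>m \<ge> s\<close> and \<open>m \<ge> 1\<close>, and this is where the case distinction on \<open>s\<close> and \<open>\<beta>\<close> is needed.
\<close>

lemma edge_potential_lower_bound:
  fixes \<beta> \<kappa> t :: real and n :: nat
  assumes \<beta>: "\<beta> \<ge> 1" and n: "n \<ge> 1" and \<kappa>: "\<kappa> \<ge> real n + 1"
    and a: "a = \<beta> / 2 * (\<kappa> - real n + 1) - 1" and s: "s = (sqrt \<kappa> - sqrt (real n))\<^sup>2"
    and cases: "s \<ge> 1 \<or> \<beta> \<ge> 2" and t: "t \<le> s"
  shows "\<beta>\<^sup>2 / 4 * (1 + 2 * (s - t) * sqrt (\<kappa> * real n))
     \<le> (a - \<beta> * t / 2)\<^sup>2 - a + 2 * \<beta> * (a - \<beta> * t / 2) - \<beta>\<^sup>2 * (real n - 1) * t"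
proof -
  define x where "x = sqrt \<kappa>"
  define z where "z = sqrt (real n)"
  define g where "g = x * z"
  define m where "m = \<kappa> - real n"
  define \<delta> where "\<delta> = s - t"
  have x2: "x\<^sup>2 = \<kappa>" and z2: "z\<^sup>2 = real n" using \<kappa> n by (auto simp: x_def z_def)
  have g: "sqrt (\<kappa> * real n) = g" by (simp add: g_def x_def z_def real_sqrt_mult)
  have z1: "z \<ge> 1" using n by (simp add: z_def)
  have xz: "x \<ge> z" using \<kappa> by (simp add: x_def z_def)
  have g1: "g \<ge> 1" using z1 xz mult_mono[of 1 x 1 z] by (simp add: g_def)
  have s': "s = (x - z)\<^sup>2" by (simp add: s x_def z_def)
  have m': "m = (x - z) * (x + z)" by (simp add: m_def x2[symmetric] z2[symmetric] power2_eq_square algebra_simps)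
  have m1: "m \<ge> 1" using \<kappa> by (simp add: m_def)
  have ms: "m \<ge> s" unfolding m' s' power2_eq_square using xz z1 by (intro mult_left_mono) auto
  have \<delta>: "\<delta> \<ge> 0" using t by (simp add: \<delta>_def)
  have id1: "m\<^sup>2 = s * (s + 4 * g)" unfolding m' s' g_def by algebra
  have nm: "2 * real n + m = s + 2 * g"
    unfolding m_def s' g_def x2[symmetric] z2[symmetric] by algebra
  have a': "a = \<beta> / 2 * (m + 1) - 1" by (simp add: a m_def algebra_simps)
  have n': "real n = (s + 2 * g - m) / 2" using nm by simp
  have t': "t = s - \<delta>" by (simp add: \<delta>_def)
  have "4 * ((a - \<beta> * t / 2)\<^sup>2 - a + 2 * \<beta> * (a - \<beta> * t / 2) - \<beta>\<^sup>2 * (real n - 1) * t)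
      - \<beta>\<^sup>2 * (1 + 2 * \<delta> * g)
      = \<beta>\<^sup>2 * (m\<^sup>2 - s * (s + 4 * g) + \<delta>\<^sup>2 + (2 * g + 2) * \<delta> - 2 * s + 6 * m + 4) - \<beta> * (6 * m + 14 - 4 * s) - 4 * \<beta> * \<delta> + 8"
    unfolding a' n' t' by (simp add: field_simps power2_eq_square)
  also have "\<dots> = (\<beta>\<^sup>2 * (6 * m - 2 * s + 4) - \<beta> * (6 * m + 14 - 4 * s) + 8)
      + (\<beta>\<^sup>2 * \<delta>\<^sup>2 + \<delta> * (\<beta> * (\<beta> * (2 * g + 2) - 4)))"
    unfolding id1 by (simp add: algebra_simps power2_eq_square)
  also have "\<dots> \<ge> 0"
  proof (rule add_nonneg_nonneg)
    have "1 * 4 \<le> \<beta> * (2 * g + 2)" using \<beta> g1 by (intro mult_mono) auto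
    then show "0 \<le> \<beta>\<^sup>2 * \<delta>\<^sup>2 + \<delta> * (\<beta> * (\<beta> * (2 * g + 2) - 4))"
      using \<beta> \<delta> by (intro add_nonneg_nonneg mult_nonneg_nonneg) auto
    have bb: "\<beta> * (\<beta> - 1) \<ge> 0" using \<beta> by simp
    show "0 \<le> \<beta>\<^sup>2 * (6 * m - 2 * s + 4) - \<beta> * (6 * m + 14 - 4 * s) + 8"
    proof (cases "s \<ge> 1")
      case True
      have "\<beta>\<^sup>2 * (6 * m - 2 * s + 4) - \<beta> * (6 * m + 14 - 4 * s) + 8
         = 6 * (\<beta> * (\<beta> - 1)) * (m - s) + 2 * (\<beta> * (\<beta> - 1) + \<beta> * \<beta>) * (s - 1) + 8 * (\<beta> - 1)\<^sup>2"
        by (simp add: algebra_simps power2_eq_square)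
      also have "\<dots> \<ge> 0" using bb ms True \<beta> by (intro add_nonneg_nonneg mult_nonneg_nonneg) auto
      finally show ?thesis .
    next
      case False
      then have b2: "\<beta> \<ge> 2" using cases by simp
      have "\<beta>\<^sup>2 * (6 * m - 2 * s + 4) - \<beta> * (6 * m + 14 - 4 * s) + 8
         = 6 * (\<beta> * (\<beta> - 1)) * (m - 1) + \<beta> * (\<beta> - 2) * (10 - 2 * s) + 8"
        by (simp add: algebra_simps power2_eq_square)
      also have "\<dots> \<ge> 0" using bb m1 False b2 \<beta> by (intro add_nonneg_nonneg mult_nonneg_nonneg) auto
      finally show ?thesis .
    qed
  qed
  finally show ?thesis by (simp add: g \<delta>_def)
qed

theorem theorem12:
  shows "\<exists>C::real. C > 0 \<and>
    (\<forall>(\<beta>::real) (n::nat) (\<kappa>::real) (\<epsilon>::real) (\<alpha>::real).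
      \<beta> \<ge> 1 \<longrightarrow> n \<ge> 1 \<longrightarrow> \<kappa> \<ge> real n + 1 \<longrightarrow>
      \<alpha> = 1 - sqrt (real n / \<kappa>) \<longrightarrow>
      0 < \<epsilon> \<longrightarrow>
      \<epsilon> \<le> sqrt (real n / \<kappa>) * min (\<alpha> ^ 14) (\<alpha> ^ 2 * real n powr (- 2 / 5)) \<longrightarrow>
      \<P>(x in laguerre_ensemble \<beta> n \<kappa>.
          lambda_min n x \<le> (sqrt \<kappa> - sqrt (real n)) ^ 2 * (1 - \<epsilon>))
        \<le> C * exp (- \<beta> * (\<kappa> * real n) powr (1 / 4) * (sqrt \<kappa> - sqrt (real n))
                     * \<epsilon> powr (3 / 2) / C))"
proof (intro exI[of _ 20] conjI allI impI)
  fix \<beta> \<kappa> \<epsilon> \<alpha> :: real and n :: nat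
  assume \<beta>: "\<beta> \<ge> 1" and n: "n \<ge> 1" and \<kappa>: "\<kappa> \<ge> real n + 1" and \<alpha>: "\<alpha> = 1 - sqrt (real n / \<kappa>)"
    and \<epsilon>: "0 < \<epsilon>" "\<epsilon> \<le> sqrt (real n / \<kappa>) * min (\<alpha> ^ 14) (\<alpha> ^ 2 * real n powr (- 2 / 5))"
  define s where "s = (sqrt \<kappa> - sqrt (real n))\<^sup>2"
  define a where "a = \<beta> / 2 * (\<kappa> - real n + 1) - 1"
  define g where "g = sqrt (\<kappa> * real n)"
  define X where "X = sqrt g * sqrt s * (\<epsilon> * sqrt \<epsilon>)"
  have \<kappa>0: "\<kappa> > 0" using \<kappa> by simp
  have less: "sqrt (real n) < sqrt \<kappa>" using \<kappa> by simp
  have s0: "s > 0" using less by (simp add: s_def)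
  have sqs: "sqrt s = sqrt \<kappa> - sqrt (real n)" using less by (simp add: s_def)
  have g0: "g \<ge> 0" using \<kappa>0 by (simp add: g_def)
  have r: "0 < sqrt (real n / \<kappa>)" "sqrt (real n / \<kappa>) < 1" using n \<kappa> \<kappa>0 by auto
  then have \<alpha>01: "0 < \<alpha>" "\<alpha> < 1" by (auto simp: \<alpha>)
  have \<epsilon>\<alpha>: "\<epsilon> \<le> \<alpha>"
  proof -
    have "\<epsilon> \<le> 1 * \<alpha> ^ 14"
      using \<epsilon>(2) r \<alpha>01 by (elim order.trans) (intro mult_mono, auto)
    also have "\<dots> \<le> \<alpha>" using \<alpha>01 power_decreasing[of 1 14 \<alpha>] by simp
    finally show ?thesis .
  qed
  have \<epsilon>1: "\<epsilon> < 1" using \<epsilon>\<alpha> \<alpha>01 by simp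
  have expo: "- \<beta> * (\<kappa> * real n) powr (1 / 4) * (sqrt \<kappa> - sqrt (real n)) * \<epsilon> powr (3 / 2) / 20 = - (\<beta> * X / 20)"
  proof -
    have "(\<kappa> * real n) powr (1 / 4) = ((\<kappa> * real n) powr (1 / 2)) powr (1 / 2)" by (simp add: powr_powr)
    also have "\<dots> = sqrt g" using \<kappa>0 by (simp add: powr_half_sqrt g_def)
    finally have 1: "(\<kappa> * real n) powr (1 / 4) = sqrt g" .
    have "\<epsilon> powr (3 / 2) = \<epsilon> powr (1 + 1 / 2)" by simp
    also have "\<dots> = \<epsilon> powr 1 * \<epsilon> powr (1 / 2)" by (rule powr_add)
    also have "\<dots> = \<epsilon> * sqrt \<epsilon>" using \<epsilon> by (simp add: powr_half_sqrt)
    finally show ?thesis unfolding 1 sqs[symmetric] X_def by simp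
  qed
  have a0: "a \<ge> 0"
  proof -
    have "1 / 2 * 2 \<le> \<beta> / 2 * (\<kappa> - real n + 1)" using \<beta> \<kappa> by (intro mult_mono) auto
    then show ?thesis by (simp add: a_def)
  qed
  note prob = laguerre_lambda_min_le[OF n \<beta> a_def a0]
  have "\<P>(x in laguerre_ensemble \<beta> n \<kappa>. lambda_min n x \<le> s * (1 - \<epsilon>)) \<le> 20 * exp (- (\<beta> * X / 20))"
  proof (cases "s \<ge> 1 \<or> \<beta> \<ge> 2")
    case True
    define K where "K = \<beta> / (5 * s) * sqrt (s * \<epsilon> * g)"
    define d where "d = s * \<epsilon> / 4"
    have K0: "K \<ge> 0" using \<beta> s0 \<epsilon> g0 by (simp add: K_def)
    have Kd: "K * d = \<beta> * X / 20"
    proof -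
      have "s * \<epsilon> = sqrt s * sqrt s * \<epsilon>" using s0 by simp
      then show ?thesis using s0 by (simp add: K_def d_def X_def real_sqrt_mult)
    qed
    have "\<P>(x in laguerre_ensemble \<beta> n \<kappa>. lambda_min n x \<le> s * (1 - \<epsilon>)) \<le> exp (- (K * d))"
    proof (rule prob)
      fix i assume i: "i < n"
      let ?J = "{..<n} - {i}"
      interpret min_at_edge ?J \<beta> a by standard (use \<beta> a0 in auto)
      have card: "real (card ?J) = real n - 1" using i n by simp
      show "(\<integral>\<^sup>+ t. ennreal (edge_density t) * indicator {0<..s * (1 - \<epsilon>)} t \<partial>lborel)
        \<le> ennreal (exp (- (K * d))) * (\<integral>\<^sup>+ t. ennreal (edge_density t) * indicator {0<..} t \<partial>lborel)"
      proof (rule nn_integral_edge_density_le[OF K0, where s = "s * (1 - \<epsilon> / 2)"])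
        \<comment> \<open>With \<open>d = s\<epsilon>/4\<close> the shifted minimum stays below \<open>s(1 - \<epsilon>/2)\<close>, where \<open>s - t \<ge> s\<epsilon>/2\<close>.\<close>
        show "d \<ge> 0" using s0 \<epsilon> by (simp add: d_def)
        show "s * (1 - \<epsilon>) + d < s * (1 - \<epsilon> / 2)" using mult_pos_pos[OF s0 \<epsilon>(1)] by (simp add: d_def algebra_simps)
        fix t assume t: "0 < t" "t < s * (1 - \<epsilon> / 2)"
        have ts: "s * \<epsilon> / 2 \<le> s - t" using t by (simp add: algebra_simps)
        have ts': "t \<le> s" using ts mult_pos_pos[OF s0 \<epsilon>(1)] by simp
        define Y where "Y = s * \<epsilon> * g"
        have Y0: "Y \<ge> 0" using s0 \<epsilon> g0 by (simp add: Y_def)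
        have Kt: "0 \<le> K * t" "K * t \<le> \<beta> / 5 * sqrt Y"
        proof -
          show "0 \<le> K * t" using K0 t by simp
          have "K * t \<le> K * s" using K0 ts' by (intro mult_left_mono)
          also have "\<dots> = \<beta> / 5 * sqrt Y" using s0 by (simp add: K_def Y_def)
          finally show "K * t \<le> \<beta> / 5 * sqrt Y" .
        qed
        have "(K * t)\<^sup>2 + 2 * \<beta> * (K * t) \<le> (\<beta> / 5 * sqrt Y)\<^sup>2 + 2 * \<beta> * (\<beta> / 5 * sqrt Y)"
          using Kt \<beta> by (intro add_mono power_mono mult_left_mono) auto
        also have "\<dots> = \<beta>\<^sup>2 * (Y / 25 + 2 / 5 * sqrt Y)"
          using Y0 by (simp add: power_mult_distrib power2_eq_square algebra_simps)
        also have "\<dots> \<le> \<beta>\<^sup>2 * (1 / 4 * (1 + Y))"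
        proof (rule mult_left_mono)
          \<comment> \<open>The constant \<open>5\<close> in \<open>K\<close> leaves room here: \<open>1/25 + 1/5 < 1/4\<close>.\<close>
          have "2 * sqrt Y \<le> 1 + Y" using zero_le_power2[of "sqrt Y - 1"] Y0 by (simp add: power2_diff)
          then show "Y / 25 + 2 / 5 * sqrt Y \<le> 1 / 4 * (1 + Y)" using Y0 by simp
        qed simp
        also have "\<dots> \<le> \<beta>\<^sup>2 / 4 * (1 + 2 * (s - t) * g)"
        proof -
          have "Y \<le> 2 * (s - t) * g" unfolding Y_def using ts g0 by (intro mult_right_mono) auto
          then have "\<beta>\<^sup>2 * (1 + Y) \<le> \<beta>\<^sup>2 * (1 + 2 * (s - t) * g)" by (intro mult_left_mono) auto
          then show ?thesis by simp
        qed
        also have "\<dots> \<le> (a - \<beta> * t / 2)\<^sup>2 - a + 2 * \<beta> * (a - \<beta> * t / 2) - \<beta>\<^sup>2 * (real n - 1) * t"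
          unfolding g_def by (rule edge_potential_lower_bound[OF \<beta> n \<kappa> a_def s_def True ts'])
        finally show "(K * t)\<^sup>2 + 2 * \<beta> * (K * t)
          \<le> (a - \<beta> * t / 2)\<^sup>2 - a + 2 * \<beta> * (a - \<beta> * t / 2) - \<beta>\<^sup>2 * real (card ?J) * t"
          unfolding card .
      qed
    qed simp
    also have "\<dots> \<le> 20 * exp (- (\<beta> * X / 20))" unfolding Kd by simp
    finally show ?thesis .
  next
    case False
    \<comment> \<open>Here \<open>X \<le> \<surd>s \<le> 1\<close> and \<open>\<beta> < 2\<close>, so the claimed bound exceeds \<open>1\<close>.\<close>
    have "\<P>(x in laguerre_ensemble \<beta> n \<kappa>. lambda_min n x \<le> s * (1 - \<epsilon>)) \<le> 1"
    proof (rule prob)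
      fix i
      show "(\<integral>\<^sup>+ t. ennreal (min_at_edge.edge_density ({..<n} - {i}) \<beta> a t) * indicator {0<..s * (1 - \<epsilon>)} t \<partial>lborel)
        \<le> ennreal 1 * (\<integral>\<^sup>+ t. ennreal (min_at_edge.edge_density ({..<n} - {i}) \<beta> a t) * indicator {0<..} t \<partial>lborel)"
        by (auto intro!: nn_integral_mono split: split_indicator)
    qed simp
    also have "1 \<le> 20 * exp (- (\<beta> * X / 20))"
    proof -
      have "X \<le> 1"
      proof -
        have "sqrt g \<le> sqrt \<kappa>"
        proof -
          have "\<kappa> * real n \<le> \<kappa> * \<kappa>" using \<kappa> \<kappa>0 by (intro mult_left_mono) auto
          then have "g \<le> sqrt (\<kappa> * \<kappa>)" unfolding g_def by (rule real_sqrt_le_mono)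
          then show ?thesis using \<kappa>0 by simp
        qed
        moreover have "sqrt s \<le> 1" using False by simp
        moreover have "\<epsilon> * sqrt \<epsilon> \<le> \<alpha> * 1" using \<epsilon>\<alpha> \<epsilon> \<epsilon>1 \<alpha>01 by (intro mult_mono) auto
        ultimately have "X \<le> sqrt \<kappa> * 1 * (\<alpha> * 1)" unfolding X_def
          by (intro mult_mono[of "sqrt g * sqrt s"] mult_mono[of "sqrt g"]) (use g0 s0 \<epsilon> \<kappa>0 in auto)
        also have "\<dots> = sqrt s" using \<kappa>0 by (simp add: \<alpha> sqs real_sqrt_divide algebra_simps)
        also have "\<dots> \<le> 1" by fact
        finally show ?thesis .
      qed
      then have "\<beta> * X \<le> 2 * 1" using False \<beta> s0 \<epsilon> g0 by (intro mult_mono) (auto simp: X_def)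
      then have "1 - 2 / 20 \<le> 1 + - (\<beta> * X / 20)" by linarith
      also have "\<dots> \<le> exp (- (\<beta> * X / 20))" by (rule exp_ge_add_one_self)
      finally show ?thesis by simp
    qed
    finally show ?thesis .
  qed
  then show "\<P>(x in laguerre_ensemble \<beta> n \<kappa>.
          lambda_min n x \<le> (sqrt \<kappa> - sqrt (real n)) ^ 2 * (1 - \<epsilon>))
        \<le> 20 * exp (- \<beta> * (\<kappa> * real n) powr (1 / 4) * (sqrt \<kappa> - sqrt (real n))
                     * \<epsilon> powr (3 / 2) / 20)"
    unfolding expo s_def .
qed simp

end
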